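(* Let $K$ be a field and let $P=K[a_1,\dots,a_m,x_1,\dots,x_{n-m}]$ (with $0\le m\le n-1$) be non-negatively $\mathbb{Z}$-graded by $W$ such that $\deg_W(a_i)=0$ for all $i$ and $\deg_W(x_j)>0$ for all $j$. Let $X^{+}=(x_1,\dots,x_{n-m})$ and $L=K(a_1,\dots,a_m)$. Let $I$ be a $W$-homogeneous ideal in $P$ such that $I\cap P_0=\{0\}$. (a) There exists a tuple of indeterminates $Z$ in $X^{+}$ which yields an optimal separating re-embedding $$\Phi_L:\; L[X^{+}]/I_L\;\longrightarrow\; L[X^{+}\setminus Z]/(I_L\cap L[X^{+}\setminus Z])$$ of the generic fiber ideal $I_L$. (b) Let $\Gamma=(c_1,\dots,c_m)\in K^m$. There exists a tuple of indeterminates $Z$ in $X^{+}$ which yields an optimal separating re-embedding $$\Phi_\Gamma:\; K[X^{+}]/I_\Gamma\;\longrightarrow\; K[X^{+}\setminus Z]/(I_\Gamma\cap K[X^{+}\setminus Z])$$ of the special fiber ideal $I_\Gamma$.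
   Context: $P_0=K[a_1,\dots,a_m]$ is the degree-$0$ component of $P$. The generic fiber ideal is $I_L=I\cdot L[X^{+}]\subseteq L[X^{+}]$. For $\Gamma=(c_1,\dots,c_m)\in K^m$, the (special) fiber ideal $I_\Gamma\subseteq K[X^{+}]$ is the image of $I$ under the substitutions $a_i\mapsto c_i$ for $i=1,\dots,m$. Let $k$ be a field, $Q=k[y_1,\dots,y_N]$, $Y=(y_1,\dots,y_N)$, and let $J\subseteq\langle y_1,\dots,y_N\rangle$ be an ideal in $Q$. For a tuple $Z=(z_1,\dots,z_s)$ of distinct indeterminates in $Y$, a tuple $F=(f_1,\dots,f_s)$ of polynomials is coherently $Z$-separating if $f_i=z_i-h_i$ with polynomials $h_i$ such that $z_i$ divides no term occurring in $h_j$ for all $i,j$. If such an $F$ lies in $J$, the $k$-algebra isomorphism $Q/J\to k[Y\setminus Z]/(J\cap k[Y\setminus Z])$ given by $z_i\mapsto h_i$ and $y_j\mapsto y_j$ for $y_j\notin Z$ is called a $Z$-separating re-embedding of $J$. A $k$-algebra isomorphism $Q/J\to Q'/J'$, with $Q'$ a polynomial ring over $k$ in $\mu$ indeterminates and $J'$ an ideal of $Q'$, is an optimal re-embedding of $J$ if $\mu$ is the minimum possible number among all such isomorphisms. An optimal separating re-embedding is an optimal re-embedding which is a $Z$-separating re-embedding. *)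

theory Defs
  imports
    "HOL-Algebra.QuotRing"
    "HOL-Library.Poly_Mapping"
    "HOL-Computational_Algebra.Fraction_Field"
begin

type_synonym 'a mpoly = "(nat \<Rightarrow>\<^sub>0 nat) \<Rightarrow>\<^sub>0 'a"

definition poly_const :: "'a::zero \<Rightarrow> 'a mpoly" where
  "poly_const c = Poly_Mapping.single 0 c"

definition poly_var :: "nat \<Rightarrow> 'a::zero_neq_one mpoly" where
  "poly_var i = Poly_Mapping.single (Poly_Mapping.single i 1) 1"

text \<open>
  The polynomial ring \<open>F[y\<^sub>i | i \<in> V]\<close>, where \<open>F\<close> is a subfield of the ambient field given by
  the type \<open>'a\<close>. The parameter \<open>F\<close> is needed because the field \<open>K(a\<^sub>1,\<dots>,a\<^sub>m)\<close> with a variable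
  number \<open>m\<close> of indeterminates is not a type; it is realised below as a subfield of a type.
\<close>

definition mpoly_ring :: "'a::comm_ring_1 set \<Rightarrow> nat set \<Rightarrow> 'a mpoly ring" where
  "mpoly_ring F V =
    \<lparr>carrier = {p. \<forall>t \<in> Poly_Mapping.keys p.
                 Poly_Mapping.keys t \<subseteq> V \<and> Poly_Mapping.lookup p t \<in> F},
     mult = (*), one = 1, zero = 0, add = (+)\<rparr>"

lemma mpoly_ring_cring:
  fixes F :: "'a::comm_ring_1 set"
  assumes "0 \<in> F" "1 \<in> F" "\<And>a b. a \<in> F \<Longrightarrow> b \<in> F \<Longrightarrow> a - b \<in> F" "\<And>a b. a \<in> F \<Longrightarrow> b \<in> F \<Longrightarrow> a * b \<in> F"
  shows "cring (mpoly_ring F V)"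
proof -
  have uminus: "- a \<in> F" if "a \<in> F" for a
    using assms(3)[OF assms(1) that] by simp
  have plus: "a + b \<in> F" if "a \<in> F" "b \<in> F" for a b
    using assms(3)[OF that(1) uminus[OF that(2)]] by simp
  have sums: "(\<Sum>x\<in>A. g x) \<in> F" if "\<And>x. x \<in> A \<Longrightarrow> g x \<in> F" for g :: "(nat \<Rightarrow>\<^sub>0 nat) \<Rightarrow> 'a" and A
    using that by (induction A rule: infinite_finite_induct) (simp_all add: plus assms(1))
  define T where "T = {t :: nat \<Rightarrow>\<^sub>0 nat. Poly_Mapping.keys t \<subseteq> V}"
  define C where "C = {p :: 'a mpoly. Poly_Mapping.keys p \<subseteq> T \<and> (\<forall>t. Poly_Mapping.lookup p t \<in> F)}"
  have T_add: "a + b \<in> T" if "a \<in> T" "b \<in> T" for a b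
    using that Poly_Mapping.keys_add[of a b] unfolding T_def by blast
  have lookup_F: "Poly_Mapping.lookup p t \<in> F"
    if "\<forall>t \<in> Poly_Mapping.keys p. Poly_Mapping.lookup p t \<in> F" for p :: "'a mpoly" and t
    using that assms(1) by (cases "t \<in> Poly_Mapping.keys p") (simp_all add: not_in_keys_iff_lookup_eq_zero)
  have C: "carrier (mpoly_ring F V) = C"
    unfolding mpoly_ring_def C_def T_def partial_object.simps using lookup_F by blast
  have add: "p + q \<in> C" if "p \<in> C" "q \<in> C" for p q
    using that Poly_Mapping.keys_add[of p q] unfolding C_def by (simp add: lookup_add plus) blast
  have neg: "- p \<in> C" if "p \<in> C" for p
    using that unfolding C_def by (simp add: uminus)
  have sums_any: "Sum_any g \<in> F" if "\<And>x. g x \<in> F" for g :: "(nat \<Rightarrow>\<^sub>0 nat) \<Rightarrow> 'a"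
    unfolding Sum_any.expand_set by (rule sums) (rule that)
  have whens: "(a when P) \<in> F" if "a \<in> F" for a P
    using that assms(1) by (cases P) simp_all
  have mult: "p * q \<in> C" if p: "p \<in> C" and q: "q \<in> C" for p q
  proof -
    have "Poly_Mapping.keys (p * q) \<subseteq> T"
    proof
      fix t assume "t \<in> Poly_Mapping.keys (p * q)"
      then obtain a b where "t = a + b" "a \<in> Poly_Mapping.keys p" "b \<in> Poly_Mapping.keys q"
        using keys_mult[of p q] by blast
      then show "t \<in> T"
        using p q T_add unfolding C_def by blast
    qed
    moreover have "Poly_Mapping.lookup (p * q) t \<in> F" for t
      unfolding times_poly_mapping.rep_eq prod_fun_def
      using p q unfolding C_def by (intro sums_any whens assms(4)) simp_all
    ultimately show ?thesis unfolding C_def by blast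
  qed
  have zero: "0 \<in> C" using assms(1) unfolding C_def by simp
  have one: "1 \<in> C" using assms(1,2) unfolding C_def T_def by (simp add: lookup_one when_def)
  have ops: "x \<oplus>\<^bsub>mpoly_ring F V\<^esub> y = x + y" "x \<otimes>\<^bsub>mpoly_ring F V\<^esub> y = x * y"
    "\<zero>\<^bsub>mpoly_ring F V\<^esub> = 0" "\<one>\<^bsub>mpoly_ring F V\<^esub> = 1" for x y
    by (simp_all add: mpoly_ring_def)
  have inv: "\<exists>y\<in>C. y + x = 0" if "x \<in> C" for x
    using neg[OF that] by (intro bexI[of _ "- x"]) simp_all
  show ?thesis
    by (intro cringI abelian_groupI comm_monoidI;
        unfold C ops; (erule inv | simp add: add mult zero one algebra_simps))
qed

text \<open>The ring homomorphism extending \<open>\<phi>\<close> on coefficients that sends the \<open>i\<close>-th indeterminate to \<open>f i\<close>.\<close>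

definition mpoly_subst :: "('a::zero \<Rightarrow> 'r::comm_semiring_1) \<Rightarrow> (nat \<Rightarrow> 'r) \<Rightarrow> 'a mpoly \<Rightarrow> 'r" where
  "mpoly_subst \<phi> f p =
    (\<Sum>t \<in> Poly_Mapping.keys p. \<phi> (Poly_Mapping.lookup p t) *
       (\<Prod>i \<in> Poly_Mapping.keys t. f i ^ Poly_Mapping.lookup t i))"

subsection \<open>Separating and optimal re-embeddings\<close>

definition mpoly_algebra_iso ::
  "'a::comm_ring_1 set \<Rightarrow> nat set \<Rightarrow> 'a mpoly set \<Rightarrow> nat set \<Rightarrow> 'a mpoly set
    \<Rightarrow> ('a mpoly set \<Rightarrow> 'a mpoly set) \<Rightarrow> bool" where
  "mpoly_algebra_iso F Y J Y' J' \<Phi> \<longleftrightarrow>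
    \<Phi> \<in> ring_iso (mpoly_ring F Y Quot J) (mpoly_ring F Y' Quot J') \<and>
    (\<forall>c \<in> F. \<Phi> (J +>\<^bsub>mpoly_ring F Y\<^esub> poly_const c) = J' +>\<^bsub>mpoly_ring F Y'\<^esub> poly_const c)"

definition var_divides_term :: "nat \<Rightarrow> (nat \<Rightarrow>\<^sub>0 nat) \<Rightarrow> bool" where
  "var_divides_term i t \<longleftrightarrow> (\<exists>s. t = Poly_Mapping.single i 1 + s)"

text \<open>The polynomial \<open>h\<^sub>j\<close> is determined by \<open>f\<^sub>j = z\<^sub>j - h\<^sub>j\<close>, that is, \<open>h\<^sub>j = z\<^sub>j - f\<^sub>j\<close>.\<close>

definition coherently_separating ::
  "'a::comm_ring_1 set \<Rightarrow> nat set \<Rightarrow> nat list \<Rightarrow> 'a mpoly list \<Rightarrow> bool" where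
  "coherently_separating F Y zs fs \<longleftrightarrow>
    distinct zs \<and> set zs \<subseteq> Y \<and> length fs = length zs \<and>
    set fs \<subseteq> carrier (mpoly_ring F Y) \<and>
    (\<forall>i < length zs. \<forall>j < length zs.
       \<forall>t \<in> Poly_Mapping.keys (poly_var (zs ! j) - fs ! j). \<not> var_divides_term (zs ! i) t)"

text \<open>
  The first two conjuncts are the standing assumptions on \<open>J\<close>: it is an ideal contained in the
  ideal generated by the indeterminates.
\<close>

definition separating_reembedding ::
  "'a::comm_ring_1 set \<Rightarrow> nat set \<Rightarrow> 'a mpoly set \<Rightarrow> nat list
    \<Rightarrow> ('a mpoly set \<Rightarrow> 'a mpoly set) \<Rightarrow> bool" where
  "separating_reembedding F Y J zs \<Phi> \<longleftrightarrow>
    ideal J (mpoly_ring F Y) \<and>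
    J \<subseteq> genideal (mpoly_ring F Y) (poly_var ` Y) \<and>
    (let Y' = Y - set zs; J' = J \<inter> carrier (mpoly_ring F Y') in
       mpoly_algebra_iso F Y J Y' J' \<Phi> \<and>
       (\<exists>fs. coherently_separating F Y zs fs \<and> set fs \<subseteq> J \<and>
          (\<forall>i < length zs. \<Phi> (J +>\<^bsub>mpoly_ring F Y\<^esub> poly_var (zs ! i)) =
             J' +>\<^bsub>mpoly_ring F Y'\<^esub> (poly_var (zs ! i) - fs ! i)) \<and>
          (\<forall>y \<in> Y'. \<Phi> (J +>\<^bsub>mpoly_ring F Y\<^esub> poly_var y) =
             J' +>\<^bsub>mpoly_ring F Y'\<^esub> poly_var y)))"

text \<open>
  Polynomial rings in \<open>\<mu>\<close> indeterminates are represented, up to renaming of the indeterminates,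
  by the rings \<open>mpoly_ring F V\<close> with \<open>V\<close> a finite set of naturals of cardinality \<open>\<mu>\<close>.
\<close>

definition optimal_reembedding ::
  "'a::comm_ring_1 set \<Rightarrow> nat set \<Rightarrow> 'a mpoly set \<Rightarrow> nat set \<Rightarrow> 'a mpoly set
    \<Rightarrow> ('a mpoly set \<Rightarrow> 'a mpoly set) \<Rightarrow> bool" where
  "optimal_reembedding F Y J Y' J' \<Phi> \<longleftrightarrow>
    finite Y' \<and> ideal J' (mpoly_ring F Y') \<and> mpoly_algebra_iso F Y J Y' J' \<Phi> \<and>
    (\<forall>V J'' \<Psi>. finite V \<and> ideal J'' (mpoly_ring F V) \<and> mpoly_algebra_iso F Y J V J'' \<Psi>
       \<longrightarrow> card Y' \<le> card V)"

definition optimal_separating_reembedding ::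
  "'a::comm_ring_1 set \<Rightarrow> nat set \<Rightarrow> 'a mpoly set \<Rightarrow> nat list
    \<Rightarrow> ('a mpoly set \<Rightarrow> 'a mpoly set) \<Rightarrow> bool" where
  "optimal_separating_reembedding F Y J zs \<Phi> \<longleftrightarrow>
    separating_reembedding F Y J zs \<Phi> \<and>
    optimal_reembedding F Y J (Y - set zs) (J \<inter> carrier (mpoly_ring F (Y - set zs))) \<Phi>"

subsection \<open>Homogeneous ideals\<close>

definition term_weight :: "(nat \<Rightarrow> int) \<Rightarrow> (nat \<Rightarrow>\<^sub>0 nat) \<Rightarrow> int" where
  "term_weight w t = (\<Sum>i \<in> Poly_Mapping.keys t. int (Poly_Mapping.lookup t i) * w i)"

definition hom_component :: "(nat \<Rightarrow> int) \<Rightarrow> int \<Rightarrow> 'a::comm_monoid_add mpoly \<Rightarrow> 'a mpoly" where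
  "hom_component w d p =
    (\<Sum>t \<in> {t \<in> Poly_Mapping.keys p. term_weight w t = d}.
       Poly_Mapping.single t (Poly_Mapping.lookup p t))"

definition homogeneous_ideal ::
  "(nat \<Rightarrow> int) \<Rightarrow> 'a::comm_ring_1 set \<Rightarrow> nat set \<Rightarrow> 'a mpoly set \<Rightarrow> bool" where
  "homogeneous_ideal w F V I \<longleftrightarrow>
    ideal I (mpoly_ring F V) \<and> (\<forall>p \<in> I. \<forall>d. hom_component w d p \<in> I)"

subsection \<open>Fiber ideals\<close>

text \<open>
  In \<open>P = K[a\<^sub>1,\<dots>,a\<^sub>m,x\<^sub>1,\<dots>,x\<^bsub>n-m\<^esub>]\<close> the indeterminate \<open>a\<^sub>i\<close> has index \<open>i - 1\<close> and \<open>x\<^sub>j\<close> has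
  index \<open>m + j - 1\<close>. The field \<open>K(a\<^sub>1,\<dots>,a\<^sub>m)\<close> is the following subfield of the fraction field of
  the polynomial ring over \<open>K\<close> in countably many indeterminates.
\<close>

definition rational_functions :: "nat \<Rightarrow> 'k::field mpoly fract set" where
  "rational_functions m =
    {Fract p q | p q. p \<in> carrier (mpoly_ring UNIV {..<m}) \<and>
                      q \<in> carrier (mpoly_ring UNIV {..<m}) \<and> q \<noteq> 0}"

lemma rational_functions_subfield:
  fixes a b :: "'k::field mpoly fract"
  shows "0 \<in> (rational_functions m :: 'k mpoly fract set)"
    and "1 \<in> (rational_functions m :: 'k mpoly fract set)"
    and "a \<in> rational_functions m \<Longrightarrow> b \<in> rational_functions m \<Longrightarrow> a - b \<in> rational_functions m"
    and "a \<in> rational_functions m \<Longrightarrow> b \<in> rational_functions m \<Longrightarrow> a * b \<in> rational_functions m"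
    and "a \<in> rational_functions m \<Longrightarrow> inverse a \<in> rational_functions m"
proof -
  let ?R = "mpoly_ring (UNIV :: 'k set) {..<m}"
  interpret R: cring ?R by (rule mpoly_ring_cring) auto
  have ops: "p * q \<in> carrier ?R" "p + q \<in> carrier ?R" "- p \<in> carrier ?R"
    if "p \<in> carrier ?R" "q \<in> carrier ?R" for p q
    using R.m_closed[OF that] R.a_closed[OF that] that by (auto simp: mpoly_ring_def)
  have diff: "p - q \<in> carrier ?R" if "p \<in> carrier ?R" "q \<in> carrier ?R" for p q
    using ops(2)[OF that(1) ops(3)[OF that(2) that(2)]] by simp
  have zo: "0 \<in> carrier ?R" "1 \<in> carrier ?R"
    using R.zero_closed R.one_closed by (auto simp: mpoly_ring_def)
  have rfI: "Fract p q \<in> rational_functions m"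
    if "p \<in> carrier ?R" "q \<in> carrier ?R" "q \<noteq> 0" for p q
    unfolding rational_functions_def using that by blast
  show z: "0 \<in> (rational_functions m :: 'k mpoly fract set)"
    unfolding Zero_fract_def using zo by (intro rfI) simp_all
  show "1 \<in> (rational_functions m :: 'k mpoly fract set)"
    unfolding One_fract_def using zo by (intro rfI) simp_all
  show "a - b \<in> rational_functions m" if ab: "a \<in> rational_functions m" "b \<in> rational_functions m"
  proof -
    obtain p q r s where *: "a = Fract p q" "b = Fract r s" "q \<noteq> 0" "s \<noteq> 0"
      "p \<in> carrier ?R" "q \<in> carrier ?R" "r \<in> carrier ?R" "s \<in> carrier ?R"
      using ab unfolding rational_functions_def by blast
    then have "a - b = Fract (p * s - r * q) (q * s)" by simp
    moreover have "Fract (p * s - r * q) (q * s) \<in> rational_functions m"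
      using * by (intro rfI diff ops(1)) simp_all
    ultimately show ?thesis by simp
  qed
  show "a * b \<in> rational_functions m" if ab: "a \<in> rational_functions m" "b \<in> rational_functions m"
  proof -
    obtain p q r s where *: "a = Fract p q" "b = Fract r s" "q \<noteq> 0" "s \<noteq> 0"
      "p \<in> carrier ?R" "q \<in> carrier ?R" "r \<in> carrier ?R" "s \<in> carrier ?R"
      using ab unfolding rational_functions_def by blast
    then have "a * b = Fract (p * r) (q * s)" by simp
    moreover have "Fract (p * r) (q * s) \<in> rational_functions m"
      using * by (intro rfI ops(1)) simp_all
    ultimately show ?thesis by simp
  qed
  show "inverse a \<in> rational_functions m" if a: "a \<in> rational_functions m"
  proof -
    obtain p q where *: "a = Fract p q" "q \<noteq> 0" "p \<in> carrier ?R" "q \<in> carrier ?R"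
      using a unfolding rational_functions_def by blast
    show ?thesis
    proof (cases "p = 0")
      case True
      then show ?thesis using * z by (simp add: fract_collapse)
    next
      case False
      then show ?thesis using * rfI[of q p] by simp
    qed
  qed
qed

definition to_generic :: "nat \<Rightarrow> 'k::field mpoly \<Rightarrow> 'k mpoly fract mpoly" where
  "to_generic m = mpoly_subst
     (\<lambda>c. poly_const (Fract (poly_const c) 1))
     (\<lambda>i. if i < m then poly_const (Fract (poly_var i) 1) else poly_var i)"

definition generic_fiber_ideal :: "nat \<Rightarrow> nat \<Rightarrow> 'k::field mpoly set \<Rightarrow> 'k mpoly fract mpoly set" where
  "generic_fiber_ideal m n I =
     genideal (mpoly_ring (rational_functions m) {m..<n}) (to_generic m ` I)"

definition special_fiber_ideal :: "nat \<Rightarrow> (nat \<Rightarrow> 'k::field) \<Rightarrow> 'k mpoly set \<Rightarrow> 'k mpoly set" where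
  "special_fiber_ideal m c I =
     mpoly_subst poly_const (\<lambda>i. if i < m then poly_const (c i) else poly_var i) ` I"

end

theory Submission
  imports Defs
begin

text \<open>
  In both cases \<open>I \<inter> P\<^sub>0 = {0}\<close> makes the fiber ideal \<open>J\<close> a homogeneous ideal inside \<open>\<langle>X\<^sup>+\<rangle>\<close> for the
  positive weights of \<open>X\<^sup>+\<close>. Choose \<open>Z\<close> maximal such that \<open>J\<close> contains a coherently separating tuple for \<open>Z\<close>;
  then no element of \<open>J' = J \<inter> k[X\<^sup>+ - Z]\<close> has a linear term. Hence the partial derivatives at the origin
  give \<open>card (X\<^sup>+ - Z)\<close> independent point derivations of \<open>k[X\<^sup>+] / J\<close> at a rational point, while a quotient
  of a polynomial ring in \<open>\<mu>\<close> indeterminates has at most \<open>\<mu>\<close> of them at any rational point.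
\<close>

subsection \<open>Polynomials over a subring and substitution\<close>

lemma mpoly_ring_simps [simp]:
  "x \<oplus>\<^bsub>mpoly_ring F V\<^esub> y = x + y" "x \<otimes>\<^bsub>mpoly_ring F V\<^esub> y = x * y"
  "\<zero>\<^bsub>mpoly_ring F V\<^esub> = 0" "\<one>\<^bsub>mpoly_ring F V\<^esub> = 1"
  by (simp_all add: mpoly_ring_def)

lemma mpoly_carrier_iff:
  "p \<in> carrier (mpoly_ring F V) \<longleftrightarrow>
    (\<forall>t \<in> Poly_Mapping.keys p. Poly_Mapping.keys t \<subseteq> V \<and> Poly_Mapping.lookup p t \<in> F)"
  by (simp add: mpoly_ring_def)

lemma mpoly_carrier_mono: "V \<subseteq> W \<Longrightarrow> carrier (mpoly_ring F V) \<subseteq> carrier (mpoly_ring F W)"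
  by (force simp: mpoly_carrier_iff)

lemma poly_mapping_sum_single: "(\<Sum>t\<in>Poly_Mapping.keys p. Poly_Mapping.single t (Poly_Mapping.lookup p t)) = p"
  by (rule poly_mapping_eqI)
    (auto simp: lookup_sum lookup_single when_def not_in_keys_iff_lookup_eq_zero
      cong: if_cong)

text \<open>The supports of the two summands may overlap, so the rule fits goals that are additive
  in \<open>p\<close>. A bilinear identity follows by two nested inductions that leave only a pair
  of monomials.\<close>

lemma poly_mapping_additive_induct [case_names zero single add]:
  fixes P :: "('a \<Rightarrow>\<^sub>0 'b::comm_monoid_add) \<Rightarrow> bool"
  assumes "P 0" "\<And>t c. P (Poly_Mapping.single t c)" "\<And>p q. P p \<Longrightarrow> P q \<Longrightarrow> P (p + q)"
  shows "P p"
proof -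
  have "P (\<Sum>t\<in>A. Poly_Mapping.single t (Poly_Mapping.lookup p t))" for A
    by (induction A rule: infinite_finite_induct) (auto intro: assms)
  then show ?thesis
    by (metis poly_mapping_sum_single)
qed

section \<open>Monomials and substitution homomorphisms\<close>

definition subst_term :: "(nat \<Rightarrow> 'r::comm_semiring_1) \<Rightarrow> (nat \<Rightarrow>\<^sub>0 nat) \<Rightarrow> 'r" where
  "subst_term f t = (\<Prod>i \<in> Poly_Mapping.keys t. f i ^ Poly_Mapping.lookup t i)"

text \<open>Lets monomials with different supports be compared factor by factor over one common
  finite set; the extra factors are zeroth powers.\<close>

lemma subst_term_superset:
  assumes "finite A" "Poly_Mapping.keys t \<subseteq> A"
  shows "subst_term f t = (\<Prod>i \<in> A. f i ^ Poly_Mapping.lookup t i)"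
  unfolding subst_term_def using assms
  by (intro prod.mono_neutral_left) (auto simp: not_in_keys_iff_lookup_eq_zero)

lemma subst_term_zero [simp]: "subst_term f 0 = 1"
  by (simp add: subst_term_def)

lemma subst_term_single [simp]: "subst_term f (Poly_Mapping.single i k) = f i ^ k"
  by (simp add: subst_term_def)

lemma subst_term_add: "subst_term f (s + t) = subst_term f s * subst_term f t"
proof -
  let ?A = "Poly_Mapping.keys s \<union> Poly_Mapping.keys t"
  have "subst_term f u = (\<Prod>i \<in> ?A. f i ^ Poly_Mapping.lookup u i)" if "u \<in> {s, t, s + t}" for u
    using that keys_add[of s t] by (intro subst_term_superset) auto
  then show ?thesis
    by (simp add: lookup_add power_add prod.distrib)
qed

locale coeff_hom =
  fixes \<phi> :: "'a::comm_ring_1 \<Rightarrow> 'r::comm_ring_1"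
  assumes hom_add: "\<phi> (a + b) = \<phi> a + \<phi> b"
    and hom_mult: "\<phi> (a * b) = \<phi> a * \<phi> b"
    and hom_one: "\<phi> 1 = 1"
begin

lemma hom_zero [simp]: "\<phi> 0 = 0"
  using hom_add[of 0 0] by simp

lemma subst_superset:
  assumes "finite A" "Poly_Mapping.keys p \<subseteq> A"
  shows "mpoly_subst \<phi> f p = (\<Sum>t \<in> A. \<phi> (Poly_Mapping.lookup p t) * subst_term f t)"
  unfolding mpoly_subst_def subst_term_def[symmetric] using assms
  by (intro sum.mono_neutral_left) (auto simp: not_in_keys_iff_lookup_eq_zero)

lemma subst_single: "mpoly_subst \<phi> f (Poly_Mapping.single t c) = \<phi> c * subst_term f t"
  using subst_superset[of "{t}" "Poly_Mapping.single t c" f] by simp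

lemma subst_zero [simp]: "mpoly_subst \<phi> f 0 = 0"
  by (simp add: mpoly_subst_def)

lemma subst_const [simp]: "mpoly_subst \<phi> f (poly_const c) = \<phi> c"
  by (simp add: poly_const_def subst_single)

lemma subst_var [simp]: "mpoly_subst \<phi> f (poly_var i) = f i"
  by (simp add: poly_var_def subst_single hom_one)

lemma subst_add: "mpoly_subst \<phi> f (p + q) = mpoly_subst \<phi> f p + mpoly_subst \<phi> f q"
proof -
  let ?A = "Poly_Mapping.keys p \<union> Poly_Mapping.keys q"
  have "mpoly_subst \<phi> f u = (\<Sum>t \<in> ?A. \<phi> (Poly_Mapping.lookup u t) * subst_term f t)"
    if "u \<in> {p, q, p + q}" for u
    using that Poly_Mapping.keys_add[of p q] by (intro subst_superset) auto
  then show ?thesis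
    by (simp add: lookup_add hom_add distrib_right sum.distrib)
qed

lemma subst_uminus: "mpoly_subst \<phi> f (- p) = - mpoly_subst \<phi> f p"
  using subst_add[of f p "- p"] by (simp add: eq_neg_iff_add_eq_0 add.commute)

lemma subst_diff: "mpoly_subst \<phi> f (p - q) = mpoly_subst \<phi> f p - mpoly_subst \<phi> f q"
  using subst_add[of f p "- q"] by (simp add: subst_uminus)

lemma subst_mult: "mpoly_subst \<phi> f (p * q) = mpoly_subst \<phi> f p * mpoly_subst \<phi> f q"
proof (induction p rule: poly_mapping_additive_induct)
  case (single s a)
  show ?case
    by (induction q rule: poly_mapping_additive_induct)
      (simp_all add: mult_single subst_single hom_mult subst_term_add subst_add algebra_simps)
qed (simp_all add: subst_add algebra_simps)

end

lemma coeff_hom_poly_const: "coeff_hom (poly_const :: 'a::comm_ring_1 \<Rightarrow> 'a mpoly)"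
  by unfold_locales (simp_all add: poly_const_def single_add mult_single)

interpretation const_hom: coeff_hom "poly_const :: 'a::comm_ring_1 \<Rightarrow> 'a mpoly"
  by (rule coeff_hom_poly_const)

section \<open>Polynomial rings with coefficients in a subring, and their induction
  principles\<close>

locale coeff_subring =
  fixes F :: "'a::comm_ring_1 set"
  assumes zero_F: "0 \<in> F" and one_F: "1 \<in> F"
    and diff_F: "a \<in> F \<Longrightarrow> b \<in> F \<Longrightarrow> a - b \<in> F"
    and mult_F: "a \<in> F \<Longrightarrow> b \<in> F \<Longrightarrow> a * b \<in> F"
begin

lemma uminus_F: "a \<in> F \<Longrightarrow> - a \<in> F"
  using diff_F[OF zero_F] by fastforce

lemma cring: "cring (mpoly_ring F V)"
  by (rule mpoly_ring_cring) (use zero_F one_F diff_F mult_F in auto)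

lemma ring: "ring (mpoly_ring F V)"
  using cring cring.axioms(1) by blast

lemma lookup_F: "p \<in> carrier (mpoly_ring F V) \<Longrightarrow> Poly_Mapping.lookup p t \<in> F"
  using zero_F by (cases "t \<in> Poly_Mapping.keys p")
    (auto simp: mpoly_carrier_iff not_in_keys_iff_lookup_eq_zero)

lemma carrier_zero: "0 \<in> carrier (mpoly_ring F V)"
  by (simp add: mpoly_carrier_iff)

lemma carrier_one: "1 \<in> carrier (mpoly_ring F V)"
  by (simp add: mpoly_carrier_iff one_F)

lemma carrier_add:
  "p \<in> carrier (mpoly_ring F V) \<Longrightarrow> q \<in> carrier (mpoly_ring F V) \<Longrightarrow> p + q \<in> carrier (mpoly_ring F V)"
  using ring.ring_simprules(1)[OF ring] by fastforce

lemma carrier_mult: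
  "p \<in> carrier (mpoly_ring F V) \<Longrightarrow> q \<in> carrier (mpoly_ring F V) \<Longrightarrow> p * q \<in> carrier (mpoly_ring F V)"
  using ring.ring_simprules(5)[OF ring] by fastforce

lemma carrier_uminus: "p \<in> carrier (mpoly_ring F V) \<Longrightarrow> - p \<in> carrier (mpoly_ring F V)"
  by (auto simp: mpoly_carrier_iff uminus_F)

lemma carrier_diff:
  "p \<in> carrier (mpoly_ring F V) \<Longrightarrow> q \<in> carrier (mpoly_ring F V) \<Longrightarrow> p - q \<in> carrier (mpoly_ring F V)"
  using carrier_add[of p V "- q"] carrier_uminus by simp

lemma carrier_single:
  "c \<in> F \<Longrightarrow> Poly_Mapping.keys t \<subseteq> V \<Longrightarrow> Poly_Mapping.single t c \<in> carrier (mpoly_ring F V)"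
  by (simp add: mpoly_carrier_iff)

lemma carrier_const: "c \<in> F \<Longrightarrow> poly_const c \<in> carrier (mpoly_ring F V)"
  by (simp add: poly_const_def carrier_single)

lemma carrier_var: "i \<in> V \<Longrightarrow> poly_var i \<in> carrier (mpoly_ring F V)"
  by (simp add: poly_var_def carrier_single one_F)

lemmas carrier_intros =
  carrier_zero carrier_one carrier_add carrier_mult carrier_uminus carrier_diff carrier_const carrier_var

lemma mpoly_monomial_induct [consumes 1, case_names zero single add]:
  assumes p: "p \<in> carrier (mpoly_ring F V)"
    and zero: "P 0"
    and single: "\<And>t c. c \<in> F \<Longrightarrow> Poly_Mapping.keys t \<subseteq> V \<Longrightarrow> P (Poly_Mapping.single t c)"
    and add: "\<And>p q. p \<in> carrier (mpoly_ring F V) \<Longrightarrow> q \<in> carrier (mpoly_ring F V) \<Longrightarrow>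
      P p \<Longrightarrow> P q \<Longrightarrow> P (p + q)"
  shows "P p"
proof -
  have "(\<Sum>t\<in>A. Poly_Mapping.single t (Poly_Mapping.lookup p t)) \<in> carrier (mpoly_ring F V) \<and>
      P (\<Sum>t\<in>A. Poly_Mapping.single t (Poly_Mapping.lookup p t))"
    if "finite A" "A \<subseteq> Poly_Mapping.keys p" for A
    using that
  proof (induction A rule: finite_induct)
    case (insert t A)
    then have "Poly_Mapping.lookup p t \<in> F" "Poly_Mapping.keys t \<subseteq> V"
      using p by (auto simp: mpoly_carrier_iff)
    then show ?case
      using insert by (simp add: add single carrier_add carrier_single)
  qed (simp add: zero carrier_zero)
  from this[of "Poly_Mapping.keys p"] show ?thesis
    by (simp add: poly_mapping_sum_single)
qed

text \<open>\<open>F[V]\<close> is generated as a ring by the constants from \<open>F\<close> and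
  the indeterminates in \<open>V\<close>. Claims compatible with sums and products therefore need
  checking only on these generators.\<close>

lemma mpoly_induct [consumes 1, case_names const var add mult]:
  assumes p: "p \<in> carrier (mpoly_ring F V)"
    and const: "\<And>c. c \<in> F \<Longrightarrow> P (poly_const c)"
    and var: "\<And>i. i \<in> V \<Longrightarrow> P (poly_var i)"
    and add: "\<And>p q. p \<in> carrier (mpoly_ring F V) \<Longrightarrow> q \<in> carrier (mpoly_ring F V) \<Longrightarrow>
      P p \<Longrightarrow> P q \<Longrightarrow> P (p + q)"
    and mult: "\<And>p q. p \<in> carrier (mpoly_ring F V) \<Longrightarrow> q \<in> carrier (mpoly_ring F V) \<Longrightarrow>
      P p \<Longrightarrow> P q \<Longrightarrow> P (p * q)"
  shows "P p"
  using p
proof (induction p rule: mpoly_monomial_induct)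
  case zero
  show ?case using const[OF zero_F] by (simp add: poly_const_def)
next
  case (single t c)
  have one: "P 1" using const[OF one_F] by (simp add: poly_const_def)
  have pow: "poly_var i ^ k \<in> carrier (mpoly_ring F V) \<and> P (poly_var i ^ k)" if "i \<in> V" for i k
    by (induction k) (auto intro: carrier_intros mult var that one)
  have prod: "(\<Prod>i\<in>A. poly_var i ^ g i) \<in> carrier (mpoly_ring F V) \<and> P (\<Prod>i\<in>A. poly_var i ^ g i)"
    if "finite A" "A \<subseteq> V" for A g
    using that by (induction A rule: finite_induct) (auto intro!: one carrier_intros mult simp: pow)
  have pow_eq: "poly_var i ^ k = Poly_Mapping.single (Poly_Mapping.single i k) (1::'a)" for i k
    by (induction k) (simp_all add: poly_var_def mult_single flip: single_add)
  have prod_eq: "(\<Prod>i\<in>A. poly_var i ^ g i) =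
      Poly_Mapping.single (\<Sum>i\<in>A. Poly_Mapping.single i (g i)) (1::'a)" if "finite A" for A g
    using that by (induction A rule: finite_induct) (simp_all add: pow_eq mult_single)
  \<comment> \<open>Every monomial is a constant times a product of powers of indeterminates, so the
    product case applies to it.\<close>
  have "Poly_Mapping.single t c =
      poly_const c * (\<Prod>i\<in>Poly_Mapping.keys t. poly_var i ^ Poly_Mapping.lookup t i)"
    by (simp add: prod_eq poly_mapping_sum_single poly_const_def mult_single)
  then show ?case
    using single by (auto intro!: mult carrier_intros const simp: prod)
qed (rule add)

lemma subst_closed:
  assumes "p \<in> carrier (mpoly_ring F V)" "\<And>i. i \<in> V \<Longrightarrow> f i \<in> carrier (mpoly_ring F W)"
  shows "mpoly_subst poly_const f p \<in> carrier (mpoly_ring F W)"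
  using assms(1)
  by (induction rule: mpoly_induct)
    (simp_all add: const_hom.subst_add const_hom.subst_mult carrier_intros assms(2))

lemma subst_id:
  assumes "p \<in> carrier (mpoly_ring F V)" "\<And>i. i \<in> V \<Longrightarrow> f i = poly_var i"
  shows "mpoly_subst poly_const f p = p"
  using assms(1)
  by (induction rule: mpoly_induct) (simp_all add: const_hom.subst_add const_hom.subst_mult assms(2))

text \<open>Closure under negation comes from absorption, applied to the factor
  \<open>-1\<close>.\<close>

lemma idealI_mpoly:
  assumes "S \<subseteq> carrier (mpoly_ring F V)" "0 \<in> S" "\<And>p q. p \<in> S \<Longrightarrow> q \<in> S \<Longrightarrow> p + q \<in> S"
    "\<And>p q. p \<in> S \<Longrightarrow> q \<in> carrier (mpoly_ring F V) \<Longrightarrow> q * p \<in> S"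
  shows "ideal S (mpoly_ring F V)"
proof -
  interpret R: cring "mpoly_ring F V" by (rule cring)
  have inv: "inv\<^bsub>add_monoid (mpoly_ring F V)\<^esub> p = - p" if "p \<in> S" for p
    using R.minus_equality[of "- p" p] that assms(1) carrier_uminus unfolding a_inv_def by auto
  show ?thesis
  proof (rule idealI)
    show "subgroup S (add_monoid (mpoly_ring F V))"
    proof (rule subgroup.intro)
      fix p assume "p \<in> S"
      then show "inv\<^bsub>add_monoid (mpoly_ring F V)\<^esub> p \<in> S"
        unfolding inv[OF \<open>p \<in> S\<close>]
        using assms(4)[of p "-1"] by (simp add: carrier_uminus carrier_one)
    qed (use assms in auto)
  qed (use assms R.ring_axioms in \<open>auto simp: mult.commute\<close>)
qed

section \<open>Congruences and cosets modulo a fixed ideal\<close>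

context
  fixes J V assumes J: "ideal J (mpoly_ring F V)"
begin

lemma ideal_subset: "p \<in> J \<Longrightarrow> p \<in> carrier (mpoly_ring F V)"
  by (rule ideal.Icarr[OF J])

lemma ideal_zero: "0 \<in> J"
  using additive_subgroup.zero_closed[OF ideal.axioms(1)[OF J]] by simp

lemma ideal_add: "p \<in> J \<Longrightarrow> q \<in> J \<Longrightarrow> p + q \<in> J"
  using additive_subgroup.a_closed[OF ideal.axioms(1)[OF J]] by simp

lemma ideal_mult: "p \<in> J \<Longrightarrow> q \<in> carrier (mpoly_ring F V) \<Longrightarrow> q * p \<in> J"
  using ideal.I_l_closed[OF J] by simp

lemma ideal_uminus: "p \<in> J \<Longrightarrow> - p \<in> J"
  using ideal_mult[of p "-1"] carrier_uminus carrier_one by simp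

lemma ideal_diff: "p \<in> J \<Longrightarrow> q \<in> J \<Longrightarrow> p - q \<in> J"
  using ideal_add[of p "- q"] ideal_uminus by simp

lemma ideal_sum: "(\<And>x. x \<in> A \<Longrightarrow> g x \<in> J) \<Longrightarrow> sum g A \<in> J"
  by (induction A rule: infinite_finite_induct) (auto intro: ideal_zero ideal_add)

text \<open>The identity and the substitution agree modulo \<open>J\<close> on generators, and
  congruence modulo an ideal respects sums and products.\<close>

lemma subst_cong_mod:
  assumes "p \<in> carrier (mpoly_ring F V)"
    and "\<And>i. i \<in> V \<Longrightarrow> f i \<in> carrier (mpoly_ring F V)" "\<And>i. i \<in> V \<Longrightarrow> poly_var i - f i \<in> J"
  shows "p - mpoly_subst poly_const f p \<in> J"
  using assms(1)
proof (induction rule: mpoly_induct)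
  case (add p q)
  have "(p - mpoly_subst poly_const f p) + (q - mpoly_subst poly_const f q) \<in> J"
    by (intro ideal_add add.IH)
  then show ?case by (simp add: const_hom.subst_add algebra_simps)
next
  case (mult p q)
  \<comment> \<open>With \<open>p'\<close> and \<open>q'\<close> for the substituted polynomials,
    this is \<open>p * q - p' * q' = q * (p - p') + p' * (q - q')\<close>.\<close>
  have "q * (p - mpoly_subst poly_const f p) + mpoly_subst poly_const f p * (q - mpoly_subst poly_const f q) \<in> J"
    using mult by (intro ideal_add ideal_mult subst_closed[OF _ assms(2)])
  then show ?case by (simp add: const_hom.subst_mult algebra_simps)
qed (simp_all add: ideal_zero assms(3))

lemma mem_coset_iff:
  "q \<in> J +>\<^bsub>mpoly_ring F V\<^esub> p \<longleftrightarrow> q - p \<in> J"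
  unfolding a_r_coset_def' by (auto intro: bexI[of _ "q - p"])

lemma coset_eq_iff:
  assumes "p \<in> carrier (mpoly_ring F V)" "q \<in> carrier (mpoly_ring F V)"
  shows "J +>\<^bsub>mpoly_ring F V\<^esub> p = J +>\<^bsub>mpoly_ring F V\<^esub> q \<longleftrightarrow> p - q \<in> J"
proof
  assume "J +>\<^bsub>mpoly_ring F V\<^esub> p = J +>\<^bsub>mpoly_ring F V\<^esub> q"
  moreover have "p \<in> J +>\<^bsub>mpoly_ring F V\<^esub> p" by (simp add: mem_coset_iff ideal_zero)
  ultimately show "p - q \<in> J" by (simp add: mem_coset_iff)
next
  assume *: "p - q \<in> J"
  have "r - p \<in> J \<longleftrightarrow> r - q \<in> J" for r
    using ideal_add[OF _ *, of "r - p"] ideal_diff[OF _ *, of "r - q"] by auto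
  then show "J +>\<^bsub>mpoly_ring F V\<^esub> p = J +>\<^bsub>mpoly_ring F V\<^esub> q"
    by (auto simp: mem_coset_iff)
qed

lemma quot_carrier: "carrier (mpoly_ring F V Quot J) = (\<lambda>p. J +>\<^bsub>mpoly_ring F V\<^esub> p) ` carrier (mpoly_ring F V)"
  by (auto simp: FactRing_simps a_r_coset_def)

lemma quot_add:
  assumes "p \<in> carrier (mpoly_ring F V)" "q \<in> carrier (mpoly_ring F V)"
  shows "(J +>\<^bsub>mpoly_ring F V\<^esub> p) \<oplus>\<^bsub>mpoly_ring F V Quot J\<^esub> (J +>\<^bsub>mpoly_ring F V\<^esub> q)
    = J +>\<^bsub>mpoly_ring F V\<^esub> (p + q)"
  using ideal.a_rcos_sum[OF J, of p q] assms by (simp add: FactRing_def)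

lemma quot_mult:
  assumes "p \<in> carrier (mpoly_ring F V)" "q \<in> carrier (mpoly_ring F V)"
  shows "(J +>\<^bsub>mpoly_ring F V\<^esub> p) \<otimes>\<^bsub>mpoly_ring F V Quot J\<^esub> (J +>\<^bsub>mpoly_ring F V\<^esub> q)
    = J +>\<^bsub>mpoly_ring F V\<^esub> (p * q)"
  using ideal.rcoset_mult_add[OF J, of p q] assms by (simp add: FactRing_def)

lemma quot_one: "\<one>\<^bsub>mpoly_ring F V Quot J\<^esub> = J +>\<^bsub>mpoly_ring F V\<^esub> 1"
  by (simp add: FactRing_def)

end

end

subsection \<open>Low-order coefficients and homogeneous components\<close>

text \<open>The constant coefficient is the value at the origin. Exponents are natural numbers, so
  two terms multiply to the term 1 only if both equal 1.\<close>

lemma lookup_mult_zero: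
  fixes p q :: "'a::comm_ring_1 mpoly"
  shows "Poly_Mapping.lookup (p * q) 0 = Poly_Mapping.lookup p 0 * Poly_Mapping.lookup q 0"
proof (induction p rule: poly_mapping_additive_induct)
  case (single s a)
  have eq: "s + t = 0 \<longleftrightarrow> s = 0 \<and> t = 0" "t + s = 0 \<longleftrightarrow> s = 0 \<and> t = 0" for t
    by (auto simp: poly_mapping_eq_iff fun_eq_iff lookup_add)
  show ?case
    by (induction q rule: poly_mapping_additive_induct)
      (auto simp: mult_single lookup_single when_def eq lookup_add algebra_simps)
qed (simp_all add: lookup_add algebra_simps)

lemma add_eq_single_one_iff:
  fixes s t :: "'a \<Rightarrow>\<^sub>0 nat"
  shows "s + t = Poly_Mapping.single y 1 \<longleftrightarrow>
    (s = 0 \<and> t = Poly_Mapping.single y 1) \<or> (s = Poly_Mapping.single y 1 \<and> t = 0)"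
proof
  assume "s + t = Poly_Mapping.single y 1"
  then have *: "Poly_Mapping.lookup s i + Poly_Mapping.lookup t i = (1 when y = i)" for i
    by (metis lookup_add lookup_single)
  have 0: "Poly_Mapping.lookup s i = 0 \<and> Poly_Mapping.lookup t i = 0" if "i \<noteq> y" for i
    using *[of i] that by simp
  consider "Poly_Mapping.lookup s y = 0" "Poly_Mapping.lookup t y = 1"
    | "Poly_Mapping.lookup s y = 1" "Poly_Mapping.lookup t y = 0"
    using *[of y] by force
  then show "(s = 0 \<and> t = Poly_Mapping.single y 1) \<or> (s = Poly_Mapping.single y 1 \<and> t = 0)"
  proof cases
    case 1
    with 0 have "s = 0" "t = Poly_Mapping.single y 1"
      by (auto intro!: poly_mapping_eqI simp: lookup_single when_def) metis+
    then show ?thesis by blast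
  next
    case 2
    with 0 have "s = Poly_Mapping.single y 1" "t = 0"
      by (auto intro!: poly_mapping_eqI simp: lookup_single when_def) metis+
    then show ?thesis by blast
  qed
qed auto

lemma single_one_neq_zero: "Poly_Mapping.single y (1::nat) \<noteq> 0"
  by (metis lookup_single_eq lookup_zero zero_neq_one)

lemma single_one_eq_iff: "Poly_Mapping.single y (1::nat) = Poly_Mapping.single k 1 \<longleftrightarrow> y = k"
  by (metis lookup_single_eq lookup_single_not_eq zero_neq_one)

text \<open>The Leibniz rule at the origin: the coefficient of \<open>y\<close> is the partial
  derivative there, and \<open>y\<close> factors into two terms only as \<open>1 * y\<close> or
  \<open>y * 1\<close>.\<close>

lemma lookup_mult_single_one:
  fixes p q :: "'a::comm_ring_1 mpoly"
  shows "Poly_Mapping.lookup (p * q) (Poly_Mapping.single y 1) =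
    Poly_Mapping.lookup p 0 * Poly_Mapping.lookup q (Poly_Mapping.single y 1) +
    Poly_Mapping.lookup p (Poly_Mapping.single y 1) * Poly_Mapping.lookup q 0"
proof (induction p rule: poly_mapping_additive_induct)
  case (single s a)
  show ?case
    by (induction q rule: poly_mapping_additive_induct)
      (auto simp: mult_single lookup_single when_def add_eq_single_one_iff single_one_neq_zero
        single_one_neq_zero[symmetric]
        lookup_add algebra_simps simp del: One_nat_def)
qed (simp_all add: lookup_add algebra_simps)

lemma lookup_const_mult:
  fixes q :: "'a::comm_ring_1 mpoly"
  shows "Poly_Mapping.lookup (poly_const c * q) t = c * Poly_Mapping.lookup q t"
  by (induction q rule: poly_mapping_additive_induct)
    (simp_all add: poly_const_def mult_single lookup_single when_def lookup_add distrib_left)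

section \<open>Weights and homogeneous components\<close>

lemma term_weight_superset:
  assumes "finite A" "Poly_Mapping.keys t \<subseteq> A"
  shows "term_weight w t = (\<Sum>i \<in> A. int (Poly_Mapping.lookup t i) * w i)"
  unfolding term_weight_def using assms
  by (intro sum.mono_neutral_left) (auto simp: not_in_keys_iff_lookup_eq_zero)

lemma term_weight_add: "term_weight w (s + t) = term_weight w s + term_weight w t"
proof -
  let ?A = "Poly_Mapping.keys s \<union> Poly_Mapping.keys t"
  have "term_weight w u = (\<Sum>i \<in> ?A. int (Poly_Mapping.lookup u i) * w i)"
    if "u \<in> {s, t, s + t}" for u
    using that keys_add[of s t] by (intro term_weight_superset) auto
  then show ?thesis
    by (simp add: lookup_add distrib_right sum.distrib)
qed

lemma term_weight_single [simp]: "term_weight w (Poly_Mapping.single i k) = int k * w i"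
  by (simp add: term_weight_def)

lemma term_weight_zero [simp]: "term_weight w 0 = 0"
  by (simp add: term_weight_def)

lemma term_weight_zero_imp:
  assumes "term_weight w t = 0" "\<And>i. i \<in> Poly_Mapping.keys t \<Longrightarrow> 0 \<le> w i" "i \<in> Poly_Mapping.keys t"
  shows "w i = 0"
proof -
  have "int (Poly_Mapping.lookup t i) * w i = 0"
    using assms(1) unfolding term_weight_def
    by (subst (asm) sum_nonneg_eq_0_iff) (use assms(2,3) in auto)
  then show ?thesis
    using assms(3) by (simp add: in_keys_iff)
qed

text \<open>Dividing \<open>t\<close> by \<open>y\<close> leaves a term of weight 0, which is
  trivial because all weights that occur are positive.\<close>

lemma term_weight_eq_var:
  assumes "term_weight w t = w y" "\<And>i. i \<in> Poly_Mapping.keys t \<Longrightarrow> 0 < w i" "y \<in> Poly_Mapping.keys t"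
  shows "t = Poly_Mapping.single y 1"
proof -
  define s where "s = t - Poly_Mapping.single y 1"
  have t: "t = Poly_Mapping.single y 1 + s"
    using assms(3) unfolding s_def
    by (intro poly_mapping_eqI)
      (auto simp: lookup_add lookup_minus lookup_single when_def in_keys_iff)
  have keys: "Poly_Mapping.keys s \<subseteq> Poly_Mapping.keys t"
    by (auto simp: t lookup_add in_keys_iff)
  have "term_weight w s = 0"
    using assms(1) by (simp add: t term_weight_add)
  then have "Poly_Mapping.keys s = {}"
    using term_weight_zero_imp[of w s] assms(2) keys by (metis equals0I less_imp_le less_irrefl subsetD)
  then show ?thesis by (simp add: t)
qed

lemma lookup_hom_component:
  "Poly_Mapping.lookup (hom_component w d p) t = (Poly_Mapping.lookup p t when term_weight w t = d)"
  by (auto simp: hom_component_def lookup_sum lookup_single when_def not_in_keys_iff_lookup_eq_zero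
      cong: if_cong)

lemma hom_component_add: "hom_component w d (p + q) = hom_component w d p + hom_component w d q"
  by (rule poly_mapping_eqI) (simp add: lookup_hom_component lookup_add when_add_distrib)

lemma hom_component_zero [simp]: "hom_component w d 0 = 0"
  by (simp add: hom_component_def)

lemma hom_component_single:
  "hom_component w d (Poly_Mapping.single t c) = (Poly_Mapping.single t c when term_weight w t = d)"
  by (rule poly_mapping_eqI) (auto simp: lookup_hom_component lookup_single when_def)

lemma hom_component_single_mult:
  fixes p :: "'a::comm_ring_1 mpoly"
  shows "hom_component w d (Poly_Mapping.single t c * p) =
    Poly_Mapping.single t c * hom_component w (d - term_weight w t) p"
  by (induction p rule: poly_mapping_additive_induct)
    (auto simp: hom_component_add distrib_left mult_single hom_component_single term_weight_add when_def)

text \<open>A homogeneous linear system with more unknowns (indexed by \<open>B\<close>) than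
  equations (indexed by \<open>V\<close>) has a nonzero solution. The induction on \<open>V\<close>
  is Gaussian elimination.\<close>

lemma nontrivial_relation:
  fixes M :: "nat \<Rightarrow> nat \<Rightarrow> 'a::field"
  assumes "finite V" "finite B" "card V < card B"
  shows "\<exists>l. (\<exists>j\<in>B. l j \<noteq> 0) \<and> (\<forall>v\<in>V. (\<Sum>j\<in>B. l j * M j v) = 0)"
  using assms
proof (induction V arbitrary: B M rule: finite_induct)
  case empty
  then obtain j where "j \<in> B" by fastforce
  then show ?case by (intro exI[of _ "\<lambda>_. 1"]) auto
next
  case (insert v V)
  show ?case
  proof (cases "\<forall>j\<in>B. M j v = 0")
    case True
    obtain l where "\<exists>j\<in>B. l j \<noteq> 0" "\<forall>v\<in>V. (\<Sum>j\<in>B. l j * M j v) = 0"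
      using insert.IH[of B M] insert.prems insert.hyps by auto
    then show ?thesis using True by (intro exI[of _ l]) auto
  next
    case False
    then obtain p where p: "p \<in> B" "M p v \<noteq> 0" by blast
    \<comment> \<open>Subtracting a multiple of row \<open>p\<close> from each row clears column
      \<open>v\<close>; the pivot \<open>M p v\<close> is nonzero.\<close>
    define N where "N j u = M j u - M j v / M p v * M p u" for j u
    obtain l where l: "\<exists>j\<in>B - {p}. l j \<noteq> 0" "\<forall>u\<in>V. (\<Sum>j\<in>B - {p}. l j * N j u) = 0"
      using insert.IH[of "B - {p}" N] insert.prems insert.hyps p by (auto simp: less_diff_conv)
    \<comment> \<open>The value at \<open>p\<close> collects the multiples of row \<open>p\<close>
      subtracted in \<open>N\<close>, so that \<open>l'\<close> acts on \<open>M\<close> as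
      \<open>l\<close> does on \<open>N\<close>.\<close>
    define l' where "l' = l(p := - (\<Sum>j\<in>B - {p}. l j * (M j v / M p v)))"
    have sum: "(\<Sum>j\<in>B. l' j * M j u) = (\<Sum>j\<in>B - {p}. l j * N j u)" for u
    proof -
      have "(\<Sum>j\<in>B. l' j * M j u) = l' p * M p u + (\<Sum>j\<in>B - {p}. l' j * M j u)"
        using insert.prems p by (simp add: sum.remove)
      also have "(\<Sum>j\<in>B - {p}. l' j * M j u) = (\<Sum>j\<in>B - {p}. l j * M j u)"
        by (rule sum.cong) (auto simp: l'_def)
      also have "l' p * M p u = - (\<Sum>j\<in>B - {p}. l j * (M j v / M p v * M p u))"
        by (simp add: l'_def sum_distrib_right mult.assoc)
      finally show ?thesis
        by (simp add: N_def right_diff_distrib sum_subtractf)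
    qed
    have "N j v = 0" for j using p by (simp add: N_def)
    then have "\<forall>u\<in>insert v V. (\<Sum>j\<in>B. l' j * M j u) = 0"
      using l(2) by (simp add: sum)
    moreover have "\<exists>j\<in>B. l' j \<noteq> 0" using l(1) by (auto simp: l'_def)
    ultimately show ?thesis by blast
  qed
qed

context coeff_subring
begin

lemma hom_component_closed:
  "p \<in> carrier (mpoly_ring F V) \<Longrightarrow> hom_component w d p \<in> carrier (mpoly_ring F V)"
  by (auto simp: mpoly_carrier_iff lookup_hom_component in_keys_iff)

text \<open>Without a constant coefficient, each term of \<open>p\<close> is divisible by some
  indeterminate, so each monomial of \<open>p\<close> lies in the ideal.\<close>

lemma genideal_vars:
  assumes p: "p \<in> carrier (mpoly_ring F V)" and zero: "Poly_Mapping.lookup p 0 = 0"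
  shows "p \<in> genideal (mpoly_ring F V) (poly_var ` V)"
proof -
  interpret R: cring "mpoly_ring F V" by (rule cring)
  have vars: "poly_var ` V \<subseteq> carrier (mpoly_ring F V)"
    using carrier_var by auto
  note J = R.genideal_ideal[OF vars]
  have "Poly_Mapping.single t (Poly_Mapping.lookup p t) \<in> genideal (mpoly_ring F V) (poly_var ` V)"
    if t: "t \<in> Poly_Mapping.keys p" for t
  proof -
    have "t \<noteq> 0" using t zero by (auto simp: in_keys_iff)
    then obtain i where i: "i \<in> Poly_Mapping.keys t" by fastforce
    define s where "s = t - Poly_Mapping.single i 1"
    have ts: "t = s + Poly_Mapping.single i 1"
      using i unfolding s_def
      by (intro poly_mapping_eqI)
        (auto simp: lookup_add lookup_minus lookup_single when_def in_keys_iff)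
    have keys: "Poly_Mapping.keys s \<subseteq> Poly_Mapping.keys t"
      by (auto simp: ts lookup_add in_keys_iff)
    have V: "Poly_Mapping.keys t \<subseteq> V" using p t by (auto simp: mpoly_carrier_iff)
    have "Poly_Mapping.single t (Poly_Mapping.lookup p t) =
        Poly_Mapping.single s (Poly_Mapping.lookup p t) * poly_var i"
      by (simp add: ts poly_var_def mult_single)
    moreover have "poly_var i \<in> genideal (mpoly_ring F V) (poly_var ` V)"
      using R.genideal_self[OF vars] i V by auto
    ultimately show ?thesis
      using ideal_mult[OF J _ carrier_single[OF lookup_F[OF p]]] keys V by auto
  qed
  then have "(\<Sum>t\<in>Poly_Mapping.keys p. Poly_Mapping.single t (Poly_Mapping.lookup p t))
      \<in> genideal (mpoly_ring F V) (poly_var ` V)"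
    by (intro ideal_sum[OF J])
  then show ?thesis by (simp add: poly_mapping_sum_single)
qed

end

subsection \<open>Separating re-embeddings and optimality\<close>

text \<open>Coherent separation phrased with a set \<open>Z\<close> in place of a list:
  \<open>h z\<close> in \<open>F[Y - Z]\<close> says that no element of \<open>Z\<close> divides a
  term of \<open>h z\<close>.\<close>

locale separated_ideal = coeff_subring F for F :: "'a::comm_ring_1 set" +
  fixes Y :: "nat set" and J :: "'a mpoly set" and Z :: "nat set" and h :: "nat \<Rightarrow> 'a mpoly"
  assumes J: "ideal J (mpoly_ring F Y)"
    and Z: "Z \<subseteq> Y"
    and h: "z \<in> Z \<Longrightarrow> h z \<in> carrier (mpoly_ring F (Y - Z))"
    and sep: "z \<in> Z \<Longrightarrow> poly_var z - h z \<in> J"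
begin

text \<open>A retraction of \<open>F[Y]\<close> onto \<open>F[Y - Z]\<close> that does not change
  classes modulo \<open>J\<close>.\<close>

definition elim :: "'a mpoly \<Rightarrow> 'a mpoly" where
  "elim = mpoly_subst poly_const (\<lambda>i. if i \<in> Z then h i else poly_var i)"

lemma carrier_Diff: "p \<in> carrier (mpoly_ring F (Y - Z)) \<Longrightarrow> p \<in> carrier (mpoly_ring F Y)"
  using mpoly_carrier_mono[of "Y - Z" Y] by auto

lemma elim_closed: "p \<in> carrier (mpoly_ring F Y) \<Longrightarrow> elim p \<in> carrier (mpoly_ring F (Y - Z))"
  unfolding elim_def by (rule subst_closed) (auto intro: h carrier_var)

lemma elim_id: "p \<in> carrier (mpoly_ring F (Y - Z)) \<Longrightarrow> elim p = p"
  unfolding elim_def by (rule subst_id) auto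

lemma elim_cong: "p \<in> carrier (mpoly_ring F Y) \<Longrightarrow> p - elim p \<in> J"
  unfolding elim_def
  by (rule subst_cong_mod[OF J]) (auto intro: carrier_Diff h carrier_var sep ideal_zero[OF J])

lemma elim_mem_iff:
  assumes "p \<in> carrier (mpoly_ring F Y)"
  shows "elim p \<in> J \<longleftrightarrow> p \<in> J"
  using ideal_add[OF J elim_cong[OF assms], of "elim p"] ideal_diff[OF J _ elim_cong[OF assms], of p]
  by auto

lemma elim_add: "elim (p + q) = elim p + elim q"
  by (simp add: elim_def const_hom.subst_add)

lemma elim_diff: "elim (p - q) = elim p - elim q"
  by (simp add: elim_def const_hom.subst_diff)

lemma elim_mult: "elim (p * q) = elim p * elim q"
  by (simp add: elim_def const_hom.subst_mult)

abbreviation J' :: "'a mpoly set" where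
  "J' \<equiv> J \<inter> carrier (mpoly_ring F (Y - Z))"

lemma J': "ideal J' (mpoly_ring F (Y - Z))"
  by (rule idealI_mpoly)
    (auto intro: ideal_zero[OF J] ideal_add[OF J] ideal_mult[OF J] carrier_Diff carrier_intros)

text \<open>The inverse of the map induced by the inclusion of \<open>F[Y - Z]\<close> in
  \<open>F[Y]\<close>. Taking the trace of a coset on the subring avoids a choice of
  representatives.\<close>

definition reembed :: "'a mpoly set \<Rightarrow> 'a mpoly set" where
  "reembed X = X \<inter> carrier (mpoly_ring F (Y - Z))"

text \<open>\<open>elim p\<close> lies both in the coset of \<open>p\<close> and in the subring, so
  the trace of the coset consists of the translates of \<open>elim p\<close> by
  \<open>J'\<close>.\<close>

lemma reembed_coset:
  assumes p: "p \<in> carrier (mpoly_ring F Y)"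
  shows "reembed (J +>\<^bsub>mpoly_ring F Y\<^esub> p) = J' +>\<^bsub>mpoly_ring F (Y - Z)\<^esub> elim p"
proof (rule Set.set_eqI)
  fix q
  let ?C = "carrier (mpoly_ring F (Y - Z))"
  have "q - p \<in> J \<longleftrightarrow> q - elim p \<in> J"
    using ideal_add[OF J _ elim_cong[OF p], of "q - p"] ideal_diff[OF J _ elim_cong[OF p], of "q - elim p"]
    by auto
  moreover have "q \<in> ?C \<longleftrightarrow> q - elim p \<in> ?C"
    using carrier_add[of "q - elim p" "Y - Z" "elim p"] carrier_diff[of q "Y - Z" "elim p"] elim_closed[OF p]
    by auto
  ultimately show "q \<in> reembed (J +>\<^bsub>mpoly_ring F Y\<^esub> p) \<longleftrightarrow>
      q \<in> J' +>\<^bsub>mpoly_ring F (Y - Z)\<^esub> elim p"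
    by (auto simp: reembed_def mem_coset_iff[OF J] mem_coset_iff[OF J'])
qed

lemma reembed_iso: "mpoly_algebra_iso F Y J (Y - Z) J' reembed"
  unfolding mpoly_algebra_iso_def
proof
  show "reembed \<in> ring_iso (mpoly_ring F Y Quot J) (mpoly_ring F (Y - Z) Quot J')"
  proof (rule ring_iso_memI)
    show "bij_betw reembed (carrier (mpoly_ring F Y Quot J)) (carrier (mpoly_ring F (Y - Z) Quot J'))"
    proof (rule bij_betwI')
      fix X X' assume "X \<in> carrier (mpoly_ring F Y Quot J)" "X' \<in> carrier (mpoly_ring F Y Quot J)"
      then obtain p q where pq: "p \<in> carrier (mpoly_ring F Y)" "q \<in> carrier (mpoly_ring F Y)"
        and X: "X = J +>\<^bsub>mpoly_ring F Y\<^esub> p" "X' = J +>\<^bsub>mpoly_ring F Y\<^esub> q"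
        by (auto simp: quot_carrier[OF J])
      \<comment> \<open>Read in the two directions, the equivalence gives injectivity and
        well-definedness.\<close>
      have "elim p - elim q \<in> J' \<longleftrightarrow> p - q \<in> J"
        using elim_mem_iff[of "p - q"] elim_closed[of "p - q"] pq by (simp add: carrier_diff elim_diff)
      then show "reembed X = reembed X' \<longleftrightarrow> X = X'"
        unfolding X reembed_coset[OF pq(1)] reembed_coset[OF pq(2)]
          coset_eq_iff[OF J pq] coset_eq_iff[OF J' elim_closed[OF pq(1)] elim_closed[OF pq(2)]] .
    next
      fix X assume "X \<in> carrier (mpoly_ring F (Y - Z) Quot J')"
      then obtain p where p: "p \<in> carrier (mpoly_ring F (Y - Z))" "X = J' +>\<^bsub>mpoly_ring F (Y - Z)\<^esub> p"
        by (auto simp: quot_carrier[OF J'])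
      \<comment> \<open>Surjectivity: \<open>p\<close> is its own preimage, since
        \<open>elim\<close> fixes the subring.\<close>
      then show "\<exists>X'\<in>carrier (mpoly_ring F Y Quot J). X = reembed X'"
        by (auto simp: quot_carrier[OF J] reembed_coset elim_id carrier_Diff intro!: bexI[of _ p])
    qed (auto simp: quot_carrier[OF J] quot_carrier[OF J'] reembed_coset elim_closed)
  qed (auto simp: quot_carrier[OF J] quot_carrier[OF J'] quot_add[OF J] quot_add[OF J']
        quot_mult[OF J] quot_mult[OF J'] quot_one[OF J] quot_one[OF J']
        reembed_coset elim_closed carrier_intros elim_add elim_mult elim_id)
qed (auto simp: reembed_coset carrier_const elim_id)

lemma reembed_separating:
  assumes "finite Y" "J \<subseteq> genideal (mpoly_ring F Y) (poly_var ` Y)"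
  shows "separating_reembedding F Y J (sorted_list_of_set Z) reembed"
proof -
  have fin: "finite Z" using assms(1) Z finite_subset by blast
  let ?zs = "sorted_list_of_set Z"
  let ?fs = "map (\<lambda>z. poly_var z - h z) ?zs"
  have zs: "?zs ! i \<in> Z" if "i < length ?zs" for i
    using that fin nth_mem[of i ?zs] by simp
  have var: "poly_var i \<in> carrier (mpoly_ring F Y)" if "i \<in> Z" for i
    using that Z by (auto intro: carrier_var)
  have elim_var: "elim (poly_var i) = (if i \<in> Z then h i else poly_var i)" for i
    by (simp add: elim_def)
  have "\<not> var_divides_term i t" if "i \<in> Z" "j \<in> Z" "t \<in> Poly_Mapping.keys (h j)" for i j t
  proof
    assume "var_divides_term i t"
    then have "i \<in> Poly_Mapping.keys t"
      by (auto simp: var_divides_term_def in_keys_iff lookup_add)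
    then show False
      using h[OF that(2)] that by (auto simp: mpoly_carrier_iff)
  qed
  then have "\<not> var_divides_term (?zs ! i) t"
    if "i < length ?zs" "j < length ?zs" "t \<in> Poly_Mapping.keys (h (?zs ! j))" for i j t
    using that zs by blast
  then have "coherently_separating F Y ?zs ?fs"
    using fin Z by (auto simp: coherently_separating_def intro: carrier_diff var carrier_Diff h)
  moreover have "set ?fs \<subseteq> J" using fin sep by auto
  moreover have "reembed (J +>\<^bsub>mpoly_ring F Y\<^esub> poly_var (?zs ! i)) =
      J' +>\<^bsub>mpoly_ring F (Y - Z)\<^esub> (poly_var (?zs ! i) - ?fs ! i)" if "i < length ?zs" for i
    using that zs[OF that] by (simp add: reembed_coset var elim_var)
  moreover have "reembed (J +>\<^bsub>mpoly_ring F Y\<^esub> poly_var y) =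
      J' +>\<^bsub>mpoly_ring F (Y - Z)\<^esub> poly_var y" if "y \<in> Y - Z" for y
    using that by (simp add: reembed_coset carrier_var elim_var)
  ultimately show ?thesis
    unfolding separating_reembedding_def Let_def using assms(2) J reembed_iso fin
    by (auto intro!: exI[of _ ?fs])
qed

end

text \<open>
  An isomorphism transports point derivations, and a point derivation of a quotient of \<open>F[V]\<close> is
  determined by its values on \<open>V\<close>.
\<close>

lemma (in coeff_subring) card_le_of_point_derivations:
  fixes D :: "nat \<Rightarrow> 'a mpoly \<Rightarrow> 'b::field" and e :: "'a mpoly \<Rightarrow> 'b"
  assumes J: "ideal J (mpoly_ring F Y)" and J'': "ideal J'' (mpoly_ring F V)"
    and iso: "mpoly_algebra_iso F Y J V J'' \<Psi>"
    and fin: "finite V" "finite B"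
    and D_ideal: "\<And>y p. y \<in> B \<Longrightarrow> p \<in> J \<Longrightarrow> D y p = 0"
    and D_add: "\<And>y p q. D y (p + q) = D y p + D y q"
    and D_mult: "\<And>y p q. D y (p * q) = e p * D y q + D y p * e q"
    and D_const: "\<And>y c. D y (poly_const c) = 0"
    and var: "\<And>k. k \<in> B \<Longrightarrow> k \<in> Y"
    and D_var: "\<And>y k. y \<in> B \<Longrightarrow> k \<in> B \<Longrightarrow> D y (poly_var k) = (if y = k then 1 else 0)"
  shows "card B \<le> card V"
proof (rule ccontr)
  assume "\<not> card B \<le> card V"
  let ?Q = "mpoly_ring F Y" let ?R = "mpoly_ring F V"
  have hom: "\<Psi> \<in> ring_iso (?Q Quot J) (?R Quot J'')"
    using iso by (auto simp: mpoly_algebra_iso_def)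
  note bij = ring_iso_memE(5)[OF hom]
  \<comment> \<open>\<open>rel p q\<close> says that \<open>q\<close> is a lift of \<open>p\<close>
    along the isomorphism. A relation serves because lifts are unique only modulo \<open>J\<close>,
    and the derivations do not see the difference.\<close>
  define rel where "rel p q \<longleftrightarrow> p \<in> carrier ?R \<and> q \<in> carrier ?Q \<and> \<Psi> (J +>\<^bsub>?Q\<^esub> q) = J'' +>\<^bsub>?R\<^esub> p" for p q
  have rel_add: "rel (p + p') (q + q')" if "rel p q" "rel p' q'" for p q p' q'
    using that ring_iso_memE(3)[OF hom, of "J +>\<^bsub>?Q\<^esub> q" "J +>\<^bsub>?Q\<^esub> q'"]
    by (auto simp: rel_def quot_carrier[OF J] quot_add[OF J] quot_add[OF J''] carrier_add)
  have rel_mult: "rel (p * p') (q * q')" if "rel p q" "rel p' q'" for p q p' q'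
    using that ring_iso_memE(2)[OF hom, of "J +>\<^bsub>?Q\<^esub> q" "J +>\<^bsub>?Q\<^esub> q'"]
    by (auto simp: rel_def quot_carrier[OF J] quot_mult[OF J] quot_mult[OF J''] carrier_mult)
  have rel_ex: "\<exists>q. rel p q" if "p \<in> carrier ?R" for p
  proof -
    have "J'' +>\<^bsub>?R\<^esub> p \<in> \<Psi> ` carrier (?Q Quot J)"
      using bij that by (auto simp: bij_betw_def quot_carrier[OF J''])
    then show ?thesis using that by (auto simp: rel_def quot_carrier[OF J])
  qed
  have rel_unique: "D y q = D y q'" if "rel p q" "rel p q'" "y \<in> B" for p q q' y
  proof -
    have "J +>\<^bsub>?Q\<^esub> q = J +>\<^bsub>?Q\<^esub> q'"
      using that bij inj_onD[of \<Psi> "carrier (?Q Quot J)"]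
      by (simp add: rel_def bij_betw_def quot_carrier[OF J])
    then have "q - q' \<in> J" using that coset_eq_iff[OF J] by (simp add: rel_def)
    then show ?thesis using D_ideal[OF that(3)] D_add[of y "q - q'" q'] by simp
  qed
  obtain g where g: "\<And>v. v \<in> V \<Longrightarrow> rel (poly_var v) (g v)"
    using rel_ex[OF carrier_var] by metis
  \<comment> \<open>With fewer elements in \<open>V\<close> than in \<open>B\<close>, some
    nontrivial combination of the derivations vanishes on the chosen lifts of all indeterminates in
    \<open>V\<close>.\<close>
  obtain l where l: "\<exists>j\<in>B. l j \<noteq> 0" "\<forall>v\<in>V. (\<Sum>j\<in>B. l j * D j (g v)) = 0"
    using nontrivial_relation[OF fin, of "\<lambda>j v. D j (g v)"] \<open>\<not> card B \<le> card V\<close> by auto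
  define E where "E q = (\<Sum>j\<in>B. l j * D j q)" for q
  have E_unique: "E q = E q'" if "rel p q" "rel p q'" for p q q'
    unfolding E_def by (rule sum.cong) (auto simp: rel_unique[OF that])
  have E_add: "E (p + q) = E p + E q" for p q
    by (simp add: E_def D_add distrib_left sum.distrib)
  have E_mult: "E (p * q) = e p * E q + E p * e q" for p q
    by (simp add: E_def D_mult distrib_left sum.distrib sum_distrib_left sum_distrib_right mult_ac)
  \<comment> \<open>\<open>E\<close> is again a derivation that kills constants, so vanishing on
    lifts of generators spreads to lifts of all of \<open>F[V]\<close>.\<close>
  have "\<forall>q. rel p q \<longrightarrow> E q = 0" if "p \<in> carrier ?R" for p
    using that
  proof (induction rule: mpoly_induct)
    case (const c)
    then have "rel (poly_const c) (poly_const c)"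
      using iso by (simp add: rel_def carrier_const mpoly_algebra_iso_def)
    moreover have "E (poly_const c) = 0" by (simp add: E_def D_const)
    ultimately show ?case using E_unique by metis
  next
    case (var i)
    then show ?case using E_unique[OF _ g[OF var]] l(2) by (auto simp: E_def)
  next
    case (add p q)
    obtain p' q' where *: "rel p p'" "rel q q'" using rel_ex add by meson
    then have "E (p' + q') = 0" using add by (simp add: E_add)
    then show ?case using E_unique[OF _ rel_add[OF *]] by auto
  next
    case (mult p q)
    obtain p' q' where *: "rel p p'" "rel q q'" using rel_ex mult by meson
    then have "E (p' * q') = 0" using mult by (simp add: E_mult)
    then show ?case using E_unique[OF _ rel_mult[OF *]] by auto
  qed
  \<comment> \<open>Each indeterminate in \<open>B\<close> is itself a lift, so \<open>E\<close>
    vanishes on it; but its value there is the coefficient \<open>l k\<close>, which forces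
    \<open>l\<close> to be zero on \<open>B\<close>.\<close>
  moreover have "\<exists>p. rel p (poly_var k)" if "k \<in> B" for k
  proof -
    have "\<Psi> (J +>\<^bsub>?Q\<^esub> poly_var k) \<in> carrier (?R Quot J'')"
      using ring_iso_memE(1)[OF hom] carrier_var[OF var[OF that]] by (auto simp: quot_carrier[OF J])
    then show ?thesis
      using carrier_var[OF var[OF that]] by (auto simp: rel_def quot_carrier[OF J''])
  qed
  ultimately have "E (poly_var k) = 0" if "k \<in> B" for k
    using that by (metis rel_def)
  moreover have "E (poly_var k) = l k" if "k \<in> B" for k
  proof -
    have "E (poly_var k) = (\<Sum>j\<in>B. if j = k then l j else 0)"
      unfolding E_def by (rule sum.cong) (auto simp: D_var that)
    then show ?thesis using that fin(2) by simp
  qed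
  ultimately show False using l(1) by auto
qed

locale coeff_subfield = coeff_subring F for F :: "'a::field set" +
  assumes inverse_F: "a \<in> F \<Longrightarrow> inverse a \<in> F"

text \<open>
  A maximal \<open>Z\<close> is optimal: if an element of \<open>J \<inter> F[Y - Z]\<close> had a linear term \<open>y\<close>, its component of
  degree \<open>w y\<close> would contain \<open>y\<close> in no other term, because all weights are positive, and \<open>y\<close> could be
  added to \<open>Z\<close>.
\<close>

lemma (in coeff_subfield) exists_optimal_separating_reembedding:
  assumes hom: "homogeneous_ideal w F Y J" and fin: "finite Y"
    and pos: "\<And>y. y \<in> Y \<Longrightarrow> 0 < w y"
    and origin: "\<And>p. p \<in> J \<Longrightarrow> Poly_Mapping.lookup p 0 = 0"
  shows "\<exists>zs \<Phi>. optimal_separating_reembedding F Y J zs \<Phi>"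
proof -
  have J: "ideal J (mpoly_ring F Y)" and comp: "\<And>p d. p \<in> J \<Longrightarrow> hom_component w d p \<in> J"
    using hom by (auto simp: homogeneous_ideal_def)
  define sep where "sep Z h \<longleftrightarrow> separated_ideal F Y J Z h" for Z h
  let ?A = "{Z. \<exists>h. sep Z h}"
  have "?A \<subseteq> Pow Y" by (auto simp: sep_def separated_ideal_def separated_ideal_axioms_def)
  then have "finite ?A" using fin by (meson finite_Pow_iff finite_subset)
  \<comment> \<open>The empty set is always separating, so a maximal \<open>Z\<close> exists among
    the finitely many candidates.\<close>
  moreover have "sep {} h" for h
    unfolding sep_def
    by (intro separated_ideal.intro separated_ideal_axioms.intro coeff_subring_axioms) (use J in auto)
  then have "?A \<noteq> {}" by blast
  ultimately obtain Z where Z: "Z \<in> ?A" and max: "\<forall>Z'\<in>?A. Z \<subseteq> Z' \<longrightarrow> Z = Z'"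
    using finite_has_maximal[of ?A] by blast
  then obtain h where "sep Z h" by blast
  then interpret separated_ideal F Y J Z h by (simp add: sep_def)
  have linear: "Poly_Mapping.lookup p (Poly_Mapping.single y 1) = 0" if p: "p \<in> J'" and y: "y \<in> Y - Z" for p y
  proof (rule ccontr)
    assume nz: "Poly_Mapping.lookup p (Poly_Mapping.single y 1) \<noteq> 0"
    let ?c = "inverse (Poly_Mapping.lookup p (Poly_Mapping.single y 1))"
    \<comment> \<open>\<open>q\<close> lies in \<open>J\<close> by homogeneity. Scaling by
      \<open>?c\<close> makes its coefficient of \<open>y\<close> equal to 1, so \<open>g\<close>
      has no linear term in \<open>y\<close>.\<close>
    define q where "q = hom_component w (w y) p"
    define g where "g = poly_var y - poly_const ?c * q"
    have q: "q \<in> J" "q \<in> carrier (mpoly_ring F (Y - Z))"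
      using p comp by (auto simp: q_def hom_component_closed)
    have c: "?c \<in> F" using p inverse_F lookup_F by blast
    have g: "g \<in> carrier (mpoly_ring F (Y - Z))"
      unfolding g_def using y q(2) c by (intro carrier_intros) auto
    have "y \<notin> Poly_Mapping.keys t" if t: "t \<in> Poly_Mapping.keys g" for t
    proof
      assume yt: "y \<in> Poly_Mapping.keys t"
      have keys: "Poly_Mapping.keys t \<subseteq> Y" using g t by (auto simp: mpoly_carrier_iff)
      have "t \<noteq> Poly_Mapping.single y 1"
        using t nz by (auto simp: g_def q_def in_keys_iff lookup_minus lookup_const_mult
            lookup_hom_component poly_var_def)
      \<comment> \<open>A term of \<open>g\<close> other than \<open>y\<close> comes from
        \<open>q\<close>, hence has weight \<open>w y\<close>; if it contained \<open>y\<close>, it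
        would have to be \<open>y\<close> itself.\<close>
      moreover from this have "Poly_Mapping.lookup q t \<noteq> 0"
        using t by (auto simp: g_def in_keys_iff lookup_minus lookup_const_mult poly_var_def lookup_single when_def)
      then have "term_weight w t = w y"
        by (auto simp: q_def lookup_hom_component when_def split: if_splits)
      ultimately show False
        using term_weight_eq_var[OF _ _ yt] pos keys by blast
    qed
    then have g': "g \<in> carrier (mpoly_ring F (Y - insert y Z))"
      using g by (auto simp: mpoly_carrier_iff)
    have gJ: "poly_var y - g \<in> J"
      using ideal_mult[OF J q(1) carrier_const[OF c]] by (simp add: g_def)
    define f where "f i = (if i = y then g else poly_var i)" for i
    have f: "f i \<in> carrier (mpoly_ring F Y)" "poly_var i - f i \<in> J" if "i \<in> Y" for i
      using that gJ carrier_Diff[OF g] by (auto simp: f_def carrier_var ideal_zero[OF J])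
    have f': "f i \<in> carrier (mpoly_ring F (Y - insert y Z))" if "i \<in> Y - Z" for i
      using that g' by (auto simp: f_def carrier_var)
    \<comment> \<open>The old \<open>h z\<close> may contain \<open>y\<close>. Replacing
      \<open>y\<close> by \<open>g\<close> in it restores coherence and alters it only by an element
      of \<open>J\<close>.\<close>
    define h' where "h' z = (if z = y then g else mpoly_subst poly_const f (h z))" for z
    have "sep (insert y Z) h'"
      unfolding sep_def
    proof (intro separated_ideal.intro separated_ideal_axioms.intro coeff_subring_axioms)
      fix z assume z: "z \<in> insert y Z"
      show "h' z \<in> carrier (mpoly_ring F (Y - insert y Z))"
        using z g' by (auto simp: h'_def intro: subst_closed[OF h f'])
      show "poly_var z - h' z \<in> J"
      proof (cases "z = y")
        case False
        then have "z \<in> Z" using z by auto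
        then have "(poly_var z - h z) + (h z - mpoly_subst poly_const f (h z)) \<in> J"
          by (intro ideal_add[OF J] sep subst_cong_mod[OF J] f carrier_Diff h)
        then show ?thesis using False by (simp add: h'_def)
      qed (simp add: h'_def gJ)
    qed (use J Z y in auto)
    then show False using max y by blast
  qed
  have "J \<subseteq> genideal (mpoly_ring F Y) (poly_var ` Y)"
    using genideal_vars ideal_subset[OF J] origin by blast
  then have "separating_reembedding F Y J (sorted_list_of_set Z) reembed"
    by (rule reembed_separating[OF fin])
  moreover have "card (Y - Z) \<le> card V"
    if V: "finite V" "ideal J'' (mpoly_ring F V)" "mpoly_algebra_iso F Y J V J'' \<Psi>" for V J'' \<Psi>
  proof (rule card_le_of_point_derivations[OF J V(2,3,1)])
    \<comment> \<open>Partial derivative at the origin, taken after eliminating \<open>Z\<close>.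
      The accompanying point is evaluation of \<open>elim p\<close> at the origin. It kills
      \<open>J\<close> because elements of \<open>J'\<close> have no linear terms.\<close>
    let ?D = "\<lambda>y p. Poly_Mapping.lookup (elim p) (Poly_Mapping.single y 1)"
    show "?D y p = 0" if "y \<in> Y - Z" "p \<in> J" for y p
      using that linear[of "elim p" y] elim_mem_iff elim_closed ideal_subset[OF J] by auto
    show "?D y (p * q) = Poly_Mapping.lookup (elim p) 0 * ?D y q + ?D y p * Poly_Mapping.lookup (elim q) 0"
      for y p q
      by (simp only: elim_mult lookup_mult_single_one)
    show "?D y (p + q) = ?D y p + ?D y q" for y p q
      by (simp add: elim_add lookup_add)
    show "?D y (poly_const c) = 0" for y c
      using single_one_neq_zero[of y] by (simp add: elim_def) (simp add: poly_const_def lookup_single)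
    show "?D y (poly_var k) = (if y = k then 1 else 0)" if "k \<in> Y - Z" for y k
      using that single_one_eq_iff[of k y] by (simp add: elim_def) (auto simp: poly_var_def lookup_single)
  qed (use fin in auto)
  moreover have "set (sorted_list_of_set Z) = Z"
    using fin Z finite_subset by (meson set_sorted_list_of_set separated_ideal.Z separated_ideal_axioms)
  ultimately have "optimal_separating_reembedding F Y J (sorted_list_of_set Z) reembed"
    unfolding optimal_separating_reembedding_def optimal_reembedding_def
    using J' reembed_iso fin by auto
  then show ?thesis by blast
qed

subsection \<open>Fiber ideals of homogeneous ideals\<close>

text \<open>
  Both fibers are instances of one situation: coefficients are mapped along \<open>\<phi>\<close> and \<open>a\<^sub>i\<close> is sent to
  a constant, which for the generic fiber is \<open>a\<^sub>i\<close> itself as an element of \<open>K(a\<^sub>1,\<dots>,a\<^sub>m)\<close>.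
\<close>

locale fiber_map = coeff_subfield F for F :: "'b::field set" +
  fixes m n :: nat and \<phi> :: "'k::field \<Rightarrow> 'b" and \<alpha> :: "nat \<Rightarrow> 'b"
  assumes phi_hom: "coeff_hom \<phi>"
    and phi_F: "\<phi> c \<in> F"
    and alpha_F: "i < m \<Longrightarrow> \<alpha> i \<in> F"
begin

definition specialize :: "'k mpoly \<Rightarrow> 'b mpoly" where
  "specialize = mpoly_subst (\<lambda>c. poly_const (\<phi> c)) (\<lambda>i. if i < m then poly_const (\<alpha> i) else poly_var i)"

sublocale const_phi: coeff_hom "\<lambda>c. poly_const (\<phi> c) :: 'b mpoly"
proof -
  interpret coeff_hom \<phi> by (rule phi_hom)
  show "coeff_hom (\<lambda>c. poly_const (\<phi> c) :: 'b mpoly)"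
    by unfold_locales
      (simp_all add: hom_add hom_mult hom_one const_hom.hom_add const_hom.hom_mult const_hom.hom_one)
qed

sublocale K: coeff_subring "UNIV :: 'k set"
  by unfold_locales auto

lemma specialize_add: "specialize (p + q) = specialize p + specialize q"
  by (simp add: specialize_def const_phi.subst_add)

lemma specialize_mult: "specialize (p * q) = specialize p * specialize q"
  by (simp add: specialize_def const_phi.subst_mult)

lemma specialize_zero [simp]: "specialize 0 = 0"
  by (simp add: specialize_def)

lemma specialize_closed:
  "p \<in> carrier (mpoly_ring UNIV {..<n}) \<Longrightarrow> specialize p \<in> carrier (mpoly_ring F {m..<n})"
proof (induction rule: K.mpoly_induct)
  case (var i)
  then show ?case by (auto simp: specialize_def carrier_var carrier_const alpha_F)
next
  case (const c)
  then show ?case by (simp add: specialize_def carrier_const phi_F)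
qed (simp_all add: specialize_add specialize_mult carrier_add carrier_mult)

text \<open>Each \<open>a_i\<close> has weight 0, so turning its powers into scalars preserves the
  weight. The scalar \<open>c'\<close> may be 0, which is why the weight is asserted of the exponent
  \<open>t'\<close>.\<close>

lemma specialize_single:
  assumes "\<And>i. i < m \<Longrightarrow> w i = 0"
  obtains t' c' where "specialize (Poly_Mapping.single t c) = Poly_Mapping.single t' c'"
    and "term_weight w t' = term_weight w t"
proof -
  define f :: "nat \<Rightarrow> 'b mpoly" where "f i = (if i < m then poly_const (\<alpha> i) else poly_var i)" for i
  have pow: "\<exists>t' c'. f i ^ k = Poly_Mapping.single t' c' \<and> term_weight w t' = int k * w i" for i k
  proof (induction k)
    case 0
    show ?case by (intro exI[of _ 0] exI[of _ 1]) simp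
  next
    case (Suc k)
    then obtain t' c' where *: "f i ^ k = Poly_Mapping.single t' c'" "term_weight w t' = int k * w i"
      by blast
    show ?case
    proof (cases "i < m")
      case True
      then show ?thesis using * assms
        by (intro exI[of _ t'] exI[of _ "\<alpha> i * c'"]) (simp add: f_def poly_const_def mult_single)
    next
      case False
      then show ?thesis using *
        by (intro exI[of _ "Poly_Mapping.single i 1 + t'"] exI[of _ c'])
          (simp add: f_def poly_var_def mult_single term_weight_add algebra_simps)
    qed
  qed
  have prod: "\<exists>t' c'. (\<Prod>i\<in>A. f i ^ g i) = Poly_Mapping.single t' c' \<and>
      term_weight w t' = (\<Sum>i\<in>A. int (g i) * w i)" if "finite A" for A and g :: "nat \<Rightarrow> nat"
    using that
  proof (induction A rule: finite_induct)
    case empty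
    show ?case by (intro exI[of _ 0] exI[of _ 1]) simp
  next
    case (insert i A)
    then obtain t' c' where *: "(\<Prod>i\<in>A. f i ^ g i) = Poly_Mapping.single t' c'"
      "term_weight w t' = (\<Sum>i\<in>A. int (g i) * w i)" by blast
    obtain s b where "f i ^ g i = Poly_Mapping.single s b" "term_weight w s = int (g i) * w i"
      using pow by blast
    then show ?case using * insert.hyps
      by (intro exI[of _ "s + t'"] exI[of _ "b * c'"]) (simp add: mult_single term_weight_add)
  qed
  obtain t' c' where "subst_term f t = Poly_Mapping.single t' c'" "term_weight w t' = term_weight w t"
    using prod[of "Poly_Mapping.keys t" "Poly_Mapping.lookup t"]
    by (auto simp: subst_term_def term_weight_def)
  moreover have "specialize (Poly_Mapping.single t c) = poly_const (\<phi> c) * subst_term f t"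
    by (simp add: specialize_def const_phi.subst_single f_def[abs_def])
  ultimately show ?thesis
    by (intro that[of t' "\<phi> c * c'"]) (simp_all add: poly_const_def mult_single)
qed

text \<open>Both sides are additive in \<open>p\<close>, and on a monomial the claim is preservation
  of weight. This carries homogeneity from \<open>I\<close> to its fibers.\<close>

lemma hom_component_specialize:
  assumes "\<And>i. i < m \<Longrightarrow> w i = 0"
  shows "hom_component w d (specialize p) = specialize (hom_component w d p)"
proof (induction p rule: poly_mapping_additive_induct)
  case (single t c)
  obtain t' c' where "specialize (Poly_Mapping.single t c) = Poly_Mapping.single t' c'"
    and "term_weight w t' = term_weight w t"
    by (rule specialize_single[OF assms])
  then show ?case by (simp add: hom_component_single when_def)
qed (simp_all add: hom_component_add specialize_add)

lemma exists_optimal_separating_reembedding_fiber: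
  assumes w0: "\<And>i. i < m \<Longrightarrow> w i = 0"
    and pos: "\<And>j. m \<le> j \<Longrightarrow> j < n \<Longrightarrow> 0 < w j"
    and hom: "homogeneous_ideal w UNIV {..<n} I"
    and I0: "I \<inter> carrier (mpoly_ring UNIV {..<m}) = {0}"
  shows "\<exists>zs \<Phi>. optimal_separating_reembedding F {m..<n}
    (genideal (mpoly_ring F {m..<n}) (specialize ` I)) zs \<Phi>"
proof (rule exists_optimal_separating_reembedding)
  have I: "ideal I (mpoly_ring UNIV {..<n})" and comp: "\<And>p d. p \<in> I \<Longrightarrow> hom_component w d p \<in> I"
    using hom by (auto simp: homogeneous_ideal_def)
  let ?R = "mpoly_ring F {m..<n}"
  define J where "J = genideal ?R (specialize ` I)"
  interpret R: cring ?R by (rule cring)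
  have sub: "specialize ` I \<subseteq> carrier ?R"
    using specialize_closed K.ideal_subset[OF I] by auto
  note J = R.genideal_ideal[OF sub, folded J_def]
  have gen: "specialize p \<in> J" if "p \<in> I" for p
    using R.genideal_self[OF sub] that by (auto simp: J_def)
  \<comment> \<open>The elements whose components all lie in \<open>J\<close> form an ideal, since
    multiplying by a monomial only shifts degrees. It contains the generators, hence all of
    \<open>J\<close>.\<close>
  have "J \<subseteq> {p \<in> carrier ?R. \<forall>d. hom_component w d p \<in> J}" (is "_ \<subseteq> ?S")
  proof -
    have mult: "hom_component w d (q * p) \<in> J" if p: "p \<in> ?S" and q: "q \<in> carrier ?R" for p q d
      using q
    proof (induction q arbitrary: d rule: mpoly_monomial_induct)
      case (single t c)
      then show ?case
        using p by (auto simp: hom_component_single_mult intro: ideal_mult[OF J] carrier_single)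
    qed (auto simp: ideal_zero[OF J] distrib_right hom_component_add intro: ideal_add[OF J])
    have "ideal ?S ?R"
      by (rule idealI_mpoly)
        (use mult in \<open>auto simp: hom_component_add intro: carrier_intros ideal_zero[OF J] ideal_add[OF J]\<close>)
    moreover have "specialize ` I \<subseteq> ?S"
      using sub gen comp by (auto simp: hom_component_specialize[OF w0])
    ultimately show ?thesis
      unfolding J_def[symmetric] using R.genideal_minimal[of ?S "specialize ` I"] by (simp add: J_def)
  qed
  then show "homogeneous_ideal w F {m..<n} (genideal ?R (specialize ` I))"
    using J by (auto simp: homogeneous_ideal_def J_def[symmetric])
  \<comment> \<open>A term of weight 0 involves no \<open>x_j\<close>, so the degree-0 component of
    \<open>p\<close> lies in both \<open>I\<close> and \<open>K[a_1,...,a_m]\<close>, whose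
    intersection is zero.\<close>
  have comp0: "hom_component w 0 p = 0" if p: "p \<in> I" for p
  proof -
    have "Poly_Mapping.keys t \<subseteq> {..<m}" if t: "t \<in> Poly_Mapping.keys (hom_component w 0 p)" for t
    proof
      fix i assume i: "i \<in> Poly_Mapping.keys t"
      have "t \<in> Poly_Mapping.keys p" "term_weight w t = 0"
        using t by (auto simp: in_keys_iff lookup_hom_component when_def split: if_splits)
      then have lt: "j < n" if "j \<in> Poly_Mapping.keys t" for j
        using K.ideal_subset[OF I p] that by (auto simp: mpoly_carrier_iff)
      then have "0 \<le> w j" if "j \<in> Poly_Mapping.keys t" for j
        using w0[of j] pos[of j] that by (cases "j < m") (auto simp: less_imp_le)
      then have "w i = 0"
        using term_weight_zero_imp[OF \<open>term_weight w t = 0\<close> _ i] by blast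
      then show "i \<in> {..<m}" using pos[of i] lt[OF i] by (cases "i < m") auto
    qed
    then have "hom_component w 0 p \<in> carrier (mpoly_ring UNIV {..<m})"
      by (auto simp: mpoly_carrier_iff)
    then show ?thesis using comp[OF p] I0 by blast
  qed
  \<comment> \<open>Polynomials vanishing at the origin form an ideal. It contains the generators:
    the constant coefficient of \<open>specialize p\<close> sits in its degree-0 component, which is
    the image of that of \<open>p\<close> and hence zero.\<close>
  have "J \<subseteq> {p \<in> carrier ?R. Poly_Mapping.lookup p 0 = 0}" (is "_ \<subseteq> ?S")
  proof -
    have "ideal ?S ?R"
      by (rule idealI_mpoly) (auto simp: lookup_add lookup_mult_zero intro: carrier_intros)
    moreover have "Poly_Mapping.lookup (specialize p) 0 = 0" if "p \<in> I" for p
    proof -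
      have "hom_component w 0 (specialize p) = 0"
        using hom_component_specialize[of w 0 p] w0 comp0[OF that] by simp
      then have "Poly_Mapping.lookup (hom_component w 0 (specialize p)) 0 = 0" by simp
      then show ?thesis by (simp add: lookup_hom_component)
    qed
    then have "specialize ` I \<subseteq> ?S" using sub by auto
    ultimately show ?thesis
      unfolding J_def by (rule R.genideal_minimal)
  qed
  then show "Poly_Mapping.lookup p 0 = 0" if "p \<in> genideal ?R (specialize ` I)" for p
    using that by (auto simp: J_def)
qed (use pos in auto)

end

section \<open>The generic and special fibers as instances of \<open>fiber_map\<close>\<close>

theorem proposition5p4:
  fixes m n :: nat
    and w :: "nat \<Rightarrow> int"
    and I :: "'k::field mpoly set"
  assumes "m < n"
    and "\<And>i. i < m \<Longrightarrow> w i = 0"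
    and "\<And>j. m \<le> j \<Longrightarrow> j < n \<Longrightarrow> w j > 0"
    and "homogeneous_ideal w UNIV {..<n} I"
    and "I \<inter> carrier (mpoly_ring UNIV {..<m}) = {0}"
  shows "(\<exists>zs \<Phi>. optimal_separating_reembedding (rational_functions m) {m..<n}
                  (generic_fiber_ideal m n I) zs \<Phi>) \<and>
         (\<forall>c :: nat \<Rightarrow> 'k. \<exists>zs \<Phi>. optimal_separating_reembedding UNIV {m..<n}
                  (special_fiber_ideal m c I) zs \<Phi>)"
proof (intro conjI allI)
  let ?L = "rational_functions m :: 'k mpoly fract set"
  have const: "Fract (poly_const c) 1 \<in> ?L" for c :: 'k
    unfolding rational_functions_def
    by (rule CollectI, intro exI[of _ "poly_const c"] exI[of _ 1]) (simp add: mpoly_carrier_iff poly_const_def)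
  have var: "Fract (poly_var i) 1 \<in> ?L" if "i < m" for i
    unfolding rational_functions_def
    by (rule CollectI, intro exI[of _ "poly_var i"] exI[of _ 1]) (simp add: that mpoly_carrier_iff poly_var_def)
  interpret L: fiber_map ?L m n "\<lambda>c. Fract (poly_const c) 1" "\<lambda>i. Fract (poly_var i) 1"
    by unfold_locales
      (auto simp: rational_functions_subfield rational_functions_subfield(2)[unfolded One_fract_def]
        const var const_hom.hom_add const_hom.hom_mult
        const_hom.hom_one One_fract_def)
  have "L.specialize = to_generic m"
    by (simp add: L.specialize_def to_generic_def)
  then show "\<exists>zs \<Phi>. optimal_separating_reembedding ?L {m..<n} (generic_fiber_ideal m n I) zs \<Phi>"
    using L.exists_optimal_separating_reembedding_fiber[OF assms(2-5)]
    by (simp add: generic_fiber_ideal_def)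
next
  fix c :: "nat \<Rightarrow> 'k"
  interpret S: fiber_map "UNIV :: 'k set" m n "\<lambda>a. a" c
    by unfold_locales auto
  let ?R = "mpoly_ring (UNIV :: 'k set) {m..<n}"
  interpret R: cring ?R by (rule S.cring)
  have I: "ideal I (mpoly_ring UNIV {..<n})" using assms(4) by (simp add: homogeneous_ideal_def)
  have fiber: "special_fiber_ideal m c I = S.specialize ` I"
    by (simp add: special_fiber_ideal_def S.specialize_def)
  \<comment> \<open>The special fiber is defined as an image, not as a generated ideal. Since
    \<open>S.specialize\<close> fixes \<open>K[X^+]\<close>, a multiple of an image is the image of
    a multiple, so the image is already an ideal.\<close>
  have "S.specialize q = q" if "q \<in> carrier ?R" for q
    using S.subst_id[OF that, of "\<lambda>i. if i < m then poly_const (c i) else poly_var i"]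
    by (simp add: S.specialize_def)
  then have mult: "q * S.specialize p = S.specialize (q * p)" if "q \<in> carrier ?R" for p q
    using that by (simp add: S.specialize_mult)
  have "carrier ?R \<subseteq> carrier (mpoly_ring UNIV {..<n})"
    by (rule mpoly_carrier_mono) auto
  then have I_mult: "q * p \<in> I" if "p \<in> I" "q \<in> carrier ?R" for p q
    using that S.ideal_mult[OF I] by blast
  have "0 \<in> S.specialize ` I"
    using S.ideal_zero[OF I] S.specialize_zero by force
  then have "ideal (S.specialize ` I) ?R"
    by (intro S.idealI_mpoly)
      (auto simp: mult S.specialize_closed S.ideal_subset[OF I] I_mult S.ideal_add[OF I]
        simp flip: S.specialize_add)
  then have "genideal ?R (S.specialize ` I) = S.specialize ` I"
    by (intro equalityI R.genideal_minimal R.genideal_self) (auto simp: S.specialize_closed S.ideal_subset[OF I])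
  then show "\<exists>zs \<Phi>. optimal_separating_reembedding UNIV {m..<n} (special_fiber_ideal m c I) zs \<Phi>"
    using S.exists_optimal_separating_reembedding_fiber[OF assms(2-5)] by (simp add: fiber)
qed

end
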